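(* Let $n\ge 1$ be an integer, let $N\in\mathbb{R}$ with $2N+n>2$, and let $a,b,s>0$, $r\ge 0$. Let $\mathbf{X}\sim GL_n(\bm\mu,\mathbf\Sigma,g_n)$ with $\bm\mu\in\mathbb{R}^n$, $\mathbf\Sigma$ an $n\times n$ positive definite matrix, and $$g_n(t)=\frac{t^{N-1}\exp(-at^{s})}{(1+\exp(-bt^{s}))^{2r}},\quad t>0.$$ The characteristic function $\psi_{\mathbf{X}}$ of $\mathbf{X}$ can be expressed as follows. 1) If $n=1$ (writing $\mu$ for the location and $\mathbf\Sigma=\sigma^2$, $\sigma>0$), then for $t\in(-\infty,\infty)$, $$\psi_{\mathbf{X}}(t)=C_1e^{it\mu}\int_0^\infty\frac{x^{N-\frac32}e^{-ax^s}}{(1+e^{-bx^s})^{2r}}\cos(t\sigma\sqrt{x})\,dx.$$ 2) If $n>1$, then for $\mathbf{t}=(t_1,\dots,t_n)^T\in\mathbb{R}^n$, $$\psi_{\mathbf{X}}(\mathbf{t})=e^{i\mathbf{t}^T\bm\mu}\sum_{j=0}^\infty\frac{(-1)^j}{(2j)!}\,\frac{q_j}{q_0}\,\frac{\Phi_{2r}^*\big(-1,\frac1s(\frac n2+j+N-1),\frac ab\big)}{\Phi_{2r}^*\big(-1,\frac1s(\frac n2+N-1),\frac ab\big)}\,(\mathbf{t}^T\mathbf\Sigma\mathbf{t})^j,$$ where $$q_x=q_x(N,n,b,s)=\frac{\Gamma\big(\frac1s(\frac n2+x+N-1)\big)}{b^{\frac1s(\frac n2+x+N-1)}}\,B\B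ig(\frac{n-1}2,\frac{2x+1}2\Big).$$
   Context: $B(\cdot,\cdot)$ is the Beta function. The generalized Hurwitz-Lerch zeta function is, for $v\ge 0$, $|z|\le 1$, $z\ne 1$, $\sigma>0$, $\alpha>0$, $$\Phi_v^*(z,\sigma,\alpha)=\frac1{\Gamma(\sigma)}\int_0^\infty\frac{t^{\sigma-1}e^{-\alpha t}}{(1-ze^{-t})^{v}}\,dt .$$ $\mathbf{X}\sim GL_n(\bm\mu,\mathbf\Sigma,g_n)$ means that $\mathbf{X}$ has density $f(\mathbf{x})=C_n|\mathbf\Sigma|^{-1/2}g_n\big((\mathbf{x}-\bm\mu)^T\mathbf\Sigma^{-1}(\mathbf{x}-\bm\mu)\big)$ on $\mathbb{R}^n$, where $C_n$ is the normalizing constant making $f$ integrate to $1$; $C_1$ is this constant for $n=1$. The characteristic function is $\psi_{\mathbf{X}}(\mathbf{t})=E(e^{i\mathbf{t}^T\mathbf{X}})$.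
   Formalization: In part 2 the series diverges for every t≠0 when s<1/2 (and for tᵀΣt>a² when s=1/2), so the identity is stated for every t at which the series converges; convergence is proved for all t if s>1/2, and for tᵀΣt<a² if s=1/2. *)

theory Defs
  imports "HOL-Probability.Probability"
begin

text \<open>
  Elements of \<open>real ^ 'n\<close> are the vectors of length \<open>n = CARD('n)\<close>.
\<close>

definition pos_def_matrix :: "real ^ 'n ^ 'n \<Rightarrow> bool" where
  "pos_def_matrix A \<longleftrightarrow> transpose A = A \<and> (\<forall>x. x \<noteq> 0 \<longrightarrow> x \<bullet> (A *v x) > 0)"

definition gl_kernel ::
  "real ^ 'n \<Rightarrow> real ^ 'n ^ 'n \<Rightarrow> (real \<Rightarrow> real) \<Rightarrow> real ^ 'n \<Rightarrow> real" where
  "gl_kernel \<mu> \<Sigma> g x =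
     det \<Sigma> powr (- 1 / 2) * g ((x - \<mu>) \<bullet> (matrix_inv \<Sigma> *v (x - \<mu>)))"

text \<open>
  The normalizing constant \<open>C\<^sub>n\<close>. By a linear change of variables it depends only on \<open>n\<close>
  and \<open>g\<close>, although the arguments \<open>\<mu>\<close> and \<open>\<Sigma>\<close> appear in the definition.
\<close>

definition gl_const ::
  "real ^ 'n \<Rightarrow> real ^ 'n ^ 'n \<Rightarrow> (real \<Rightarrow> real) \<Rightarrow> real" where
  "gl_const \<mu> \<Sigma> g = 1 / (LINT x|lborel. gl_kernel \<mu> \<Sigma> g x)"

definition GL_distributed ::
  "'a measure \<Rightarrow> ('a \<Rightarrow> real ^ 'n) \<Rightarrow> real ^ 'n \<Rightarrow> real ^ 'n ^ 'n \<Rightarrow> (real \<Rightarrow> real) \<Rightarrow> bool" where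
  "GL_distributed M X \<mu> \<Sigma> g \<longleftrightarrow>
     prob_space M \<and>
     distributed M lborel X (\<lambda>x. ennreal (gl_const \<mu> \<Sigma> g * gl_kernel \<mu> \<Sigma> g x))"

text \<open>Only the values at \<open>t > 0\<close> matter: the value at \<open>0\<close> affects the density on a null set.\<close>

definition gl_generator ::
  "real \<Rightarrow> real \<Rightarrow> real \<Rightarrow> real \<Rightarrow> real \<Rightarrow> real \<Rightarrow> real" where
  "gl_generator N a b s r t =
     t powr (N - 1) * exp (- a * t powr s) / (1 + exp (- b * t powr s)) powr (2 * r)"

definition char_fun :: "'a measure \<Rightarrow> ('a \<Rightarrow> real ^ 'n) \<Rightarrow> real ^ 'n \<Rightarrow> complex" where
  "char_fun M X t = (CLINT \<omega>|M. exp (\<i> * of_real (t \<bullet> X \<omega>)))"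

text \<open>
  Meant for \<open>v \<ge> 0\<close>, \<open>norm z \<le> 1\<close>, \<open>z \<noteq> 1\<close>, \<open>\<sigma> > 0\<close>, \<open>\<alpha> > 0\<close>. The base \<open>1 - z * exp (- t)\<close>
  then has positive real part, so the principal branch used by \<open>powr\<close> is the natural one.
\<close>

definition hurwitz_lerch_star :: "real \<Rightarrow> complex \<Rightarrow> real \<Rightarrow> real \<Rightarrow> complex" where
  "hurwitz_lerch_star v z \<sigma> \<alpha> =
     1 / of_real (Gamma \<sigma>) *
     (CLINT t:{0<..}|lborel.
        of_real (t powr (\<sigma> - 1) * exp (- \<alpha> * t)) / (1 - z * of_real (exp (- t))) powr of_real v)"

definition gl_q :: "real \<Rightarrow> nat \<Rightarrow> real \<Rightarrow> real \<Rightarrow> real \<Rightarrow> real" where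
  "gl_q N n b s x =
     Gamma (1 / s * (real n / 2 + x + N - 1)) / b powr (1 / s * (real n / 2 + x + N - 1)) *
     Beta ((real n - 1) / 2) ((2 * x + 1) / 2)"

text \<open>
  Up to bounded factors and powers of \<open>j\<close>, the modulus of the \<open>j\<close>-th term grows like
  \<open>Gamma ((j + c) / s) * a powr (- j / s) * u ^ j / fact (2 * j)\<close> with \<open>u = t \<bullet> (\<Sigma> *v t)\<close>.
  The series converges for all \<open>t\<close> if \<open>s > 1 / 2\<close>, has radius of convergence
  \<open>a\<^sup>2\<close> in \<open>u\<close> if \<open>s = 1 / 2\<close>, and diverges for all \<open>t \<noteq> 0\<close> if \<open>s < 1 / 2\<close>. Statements about
  its sum therefore need convergence to be addressed separately.
\<close>

definition gl_series_term ::
  "real \<Rightarrow> real \<Rightarrow> real \<Rightarrow> real \<Rightarrow> real \<Rightarrow> real ^ 'n ^ 'n \<Rightarrow> real ^ 'n \<Rightarrow> nat \<Rightarrow> complex" where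
  "gl_series_term N a b s r \<Sigma> t j =
     of_real ((-1) ^ j / fact (2 * j)) *
     of_real (gl_q N CARD('n) b s (real j) / gl_q N CARD('n) b s 0) *
     (hurwitz_lerch_star (2 * r) (-1) (1 / s * (real CARD('n) / 2 + real j + N - 1)) (a / b) /
      hurwitz_lerch_star (2 * r) (-1) (1 / s * (real CARD('n) / 2 + N - 1)) (a / b)) *
     of_real ((t \<bullet> (\<Sigma> *v t)) ^ j)"

end

theory Submission
  imports Defs "HOL-Complex_Analysis.Cauchy_Integral_Formula"
begin

text \<open>
  Write \<open>Q y = y \<bullet> (matrix_inv \<Sigma> *v y)\<close>, \<open>u = t \<bullet> (\<Sigma> *v t)\<close> and \<open>n = CARD('n)\<close>. The density of
  \<open>Y = X - \<mu>\<close> is a constant multiple of \<open>g (Q y)\<close>. It is even, so the characteristic function is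
  \<open>exp (\<i> (t \<bullet> \<mu>))\<close> times the expectation of \<open>cos (t \<bullet> Y)\<close>, and everything is about that real number.

  \<^bold>\<open>Moments.\<close> The textbook argument writes \<open>Y\<close> as a radius times a uniform direction, after a
  linear map that turns \<open>\<Sigma>\<close> into the identity. Scaling alone is enough here. The function
  \<open>(t \<bullet> y) ^ (2 * j)\<close> is homogeneous, hence the image under \<open>Q\<close> of the measure with this density has
  a distribution function proportional to \<open>x powr (n / 2 + j)\<close>, so that
  \<open>\<integral> (t \<bullet> y) ^ (2 * j) * h (Q y)\<close> is a constant \<open>K\<^sub>j\<close> times \<open>\<integral>\<^sub>0\<^sup>\<infinity> \<rho> powr (n / 2 + j - 1) * h \<rho>\<close> for every
  \<open>h\<close> (\<open>distr_homogeneous_density\<close>). The choice \<open>h \<rho> = exp (- \<rho>)\<close> identifies \<open>K\<^sub>j\<close> by a Gaussian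
  integral; a translation of \<open>y\<close> completes the square in \<open>\<integral> exp (\<tau> (t \<bullet> y) - Q y)\<close>, and comparing
  coefficients of powers of \<open>\<tau>\<close> gives \<open>K\<^sub>j\<close> up to a factor independent of \<open>j\<close>
  (\<open>nn_integral_inner_power_gaussian\<close>). That factor cancels against the normalization of the density.
  With \<open>h = g\<close> and the substitution \<open>x = b * \<rho> powr s\<close>, the remaining radial integral is, up to
  elementary factors, a Gamma value times a Hurwitz-Lerch value, and the \<open>j\<close>-th term of
  the series is \<open>(-1) ^ j / fact (2 * j)\<close> times the \<open>2 j\<close>-th moment of \<open>t \<bullet> Y\<close> (\<open>gl_series_term_moment\<close>).

  \<^bold>\<open>Summation.\<close> Expanding the cosine and exchanging sum and expectation needs absolute convergence,
  while the series may converge only conditionally (for \<open>s = 1 / 2\<close> at \<open>u = a\<^sup>2\<close>). But if the series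
  converges at \<open>t\<close>, then, as a power series in \<open>x\<close>, its value at \<open>x < 1\<close>, which belongs to
  \<open>sqrt x *\<^sub>R t\<close>, converges absolutely. There the exchange is legitimate, and Abel's limit theorem on one
  side and dominated convergence on the other let \<open>x\<close> tend to \<open>1\<close>
  (\<open>expectation_cos_even_moments\<close>). Convergence itself, for
  \<open>s > 1 / 2\<close> or \<open>s = 1 / 2\<close> and \<open>u < a\<^sup>2\<close>, follows from the finiteness of the expectation of
  \<open>cosh (t \<bullet> Y)\<close>, which the inequality \<open>(t \<bullet> y)\<^sup>2 \<le> u * Q y\<close> reduces to a radial integral.

  \<^bold>\<open>The univariate case.\<close> If \<open>n = 1\<close> then \<open>cos (t \<bullet> y)\<close> is a function of \<open>Q y\<close>, so the same scaling
  argument turns its expectation into a radial integral directly.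
\<close>

section \<open>Homogeneous weights and radial functions\<close>

lemma nn_integral_lborel_scaleR:
  fixes \<phi> :: "'a::euclidean_space \<Rightarrow> ennreal"
  assumes [measurable]: "\<phi> \<in> borel_measurable borel" and c: "c > 0"
  shows "(\<integral>\<^sup>+y. \<phi> y \<partial>lborel) = ennreal (c ^ DIM('a)) * (\<integral>\<^sup>+y. \<phi> (c *\<^sub>R y) \<partial>lborel)"
proof -
  have "(\<integral>\<^sup>+y. \<phi> y \<partial>lborel)
      = (\<integral>\<^sup>+y. \<phi> y \<partial>density (distr lborel borel (\<lambda>x. 0 + c *\<^sub>R x)) (\<lambda>_. ennreal (\<bar>c\<bar> ^ DIM('a))))"
    using c by (subst lborel_affine[of c "0::'a"]) auto
  also have "\<dots> = ennreal (c ^ DIM('a)) * (\<integral>\<^sup>+y. \<phi> (c *\<^sub>R y) \<partial>lborel)"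
    using c by (simp add: nn_integral_density nn_integral_distr nn_integral_cmult)
  finally show ?thesis .
qed

lemma nn_integral_power_density:
  fixes k x :: real
  assumes "k > 0" "x \<ge> 0"
  shows "(\<integral>\<^sup>+\<rho>. ennreal (k * \<rho> powr (k - 1)) * indicator {0<..x} \<rho> \<partial>lborel) = ennreal (x powr k)"
proof -
  have "((\<lambda>\<rho>. \<rho> powr (k - 1)) has_integral (x powr (k - 1 + 1) / (k - 1 + 1))) {0..x}"
    using assms by (intro has_integral_powr_from_0) auto
  then have "((\<lambda>\<rho>. k * \<rho> powr (k - 1)) has_integral (k * (x powr k / k))) {0..x}"
    by (intro has_integral_mult_right) simp
  then have "(\<integral>\<^sup>+\<rho>. indicator {0..x} \<rho> * (k * \<rho> powr (k - 1)) \<partial>lborel) = ennreal (x powr k)"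
    using assms by (subst nn_integral_has_integral_lebesgue[where I = "x powr k"]) auto
  also have "(\<integral>\<^sup>+\<rho>. indicator {0..x} \<rho> * (k * \<rho> powr (k - 1)) \<partial>lborel)
     = (\<integral>\<^sup>+\<rho>. ennreal (k * \<rho> powr (k - 1)) * indicator {0<..x} \<rho> \<partial>lborel)"
    by (intro nn_integral_cong) (auto simp: indicator_def)
  finally show ?thesis .
qed

text \<open>
  Replacing \<open>y\<close> by \<open>x powr (1 / p) *\<^sub>R y\<close> maps the sublevel set of \<open>Q\<close> at \<open>1\<close> to the one at \<open>x\<close> and
  multiplies \<open>F y\<close> times Lebesgue measure by \<open>x powr k\<close>. Both measures therefore agree on all sets
  \<open>{..x}\<close>, which generate the Borel sets. This replaces polar coordinates for an arbitrary positive homogeneous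
  \<open>Q\<close>; in dimension one it is a substitution rule.
\<close>

lemma distr_homogeneous_density:
  fixes F :: "'a::euclidean_space \<Rightarrow> ennreal" and Q :: "'a \<Rightarrow> real" and d p :: real
  assumes [measurable]: "F \<in> borel_measurable borel" "Q \<in> borel_measurable borel"
    and p: "p > 0" and dim: "real DIM('a) + d > 0"
    and F: "\<And>c y. c > 0 \<Longrightarrow> F (c *\<^sub>R y) = ennreal (c powr d) * F y"
    and Q: "\<And>c y. c > 0 \<Longrightarrow> Q (c *\<^sub>R y) = c powr p * Q y"
    and Qpos: "\<And>y. y \<noteq> 0 \<Longrightarrow> Q y > 0"
    and V: "(\<integral>\<^sup>+y. F y * indicator {y. Q y \<le> 1} y \<partial>lborel) = V" "V < \<infinity>"
  defines "k \<equiv> (real DIM('a) + d) / p"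
  shows "distr (density lborel F) borel Q
       = density lborel (\<lambda>\<rho>. V * (ennreal (k * \<rho> powr (k - 1)) * indicator {0<..} \<rho>))"
proof (rule measure_eqI_generator_eq[where E = "range atMost" and \<Omega> = UNIV and A = "\<lambda>i. {..real i}"])
  have k: "k > 0" using p dim by (simp add: k_def)
  have L: "emeasure (distr (density lborel F) borel Q) {..x}
       = (if x > 0 then V * ennreal (x powr k) else 0)" for x
  proof -
    have "emeasure (distr (density lborel F) borel Q) {..x}
        = (\<integral>\<^sup>+y. F y * indicator {y. Q y \<le> x} y \<partial>lborel)"
      by (subst emeasure_distr)
         (auto simp: emeasure_density vimage_def intro!: nn_integral_cong)
    also have "\<dots> = (if x > 0 then V * ennreal (x powr k) else 0)"
    proof (cases "x > 0")
      case True
      define c where "c = x powr (1 / p)"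
      have c: "c > 0" "c powr p = x" using True p by (auto simp: c_def powr_powr)
      have "(\<integral>\<^sup>+y. F y * indicator {y. Q y \<le> x} y \<partial>lborel)
         = ennreal (c ^ DIM('a)) *
           (\<integral>\<^sup>+y. F (c *\<^sub>R y) * indicator {y. Q y \<le> x} (c *\<^sub>R y) \<partial>lborel)"
        using c by (intro nn_integral_lborel_scaleR) auto
      also have "(\<integral>\<^sup>+y. F (c *\<^sub>R y) * indicator {y. Q y \<le> x} (c *\<^sub>R y) \<partial>lborel)
         = (\<integral>\<^sup>+y. ennreal (c powr d) * (F y * indicator {y. Q y \<le> 1} y) \<partial>lborel)"
        using c True by (intro nn_integral_cong) (auto simp: F Q indicator_def)
      also have "\<dots> = ennreal (c powr d) * V"
        by (subst nn_integral_cmult) (auto simp: V)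
      also have "ennreal (c ^ DIM('a)) * (ennreal (c powr d) * V)
          = V * ennreal (c powr (real DIM('a) + d))"
        using c by (simp add: powr_add ennreal_mult powr_realpow ac_simps)
      also have "c powr (real DIM('a) + d) = x powr k"
        by (simp add: c_def k_def powr_powr)
      finally show ?thesis using True by simp
    next
      case False
      have "(\<integral>\<^sup>+y. F y * indicator {y. Q y \<le> x} y \<partial>lborel) = (\<integral>\<^sup>+(y::'a). 0 \<partial>lborel)"
      proof (rule nn_integral_cong_AE)
        show "AE y in lborel. F y * indicator {y. Q y \<le> x} y = 0"
          \<comment> \<open>For \<open>x \<le> 0\<close> the sublevel set is contained in \<open>{0}\<close>, a null set.\<close>
          using AE_lborel_singleton[of "0::'a"]
        proof eventually_elim
          case (elim y)
          then show ?case using Qpos[of y] False by (auto simp: indicator_def)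
        qed
      qed
      then show ?thesis using False by simp
    qed
    finally show ?thesis .
  qed
  show "emeasure (distr (density lborel F) borel Q) S
    = emeasure (density lborel (\<lambda>\<rho>. V * (ennreal (k * \<rho> powr (k - 1)) * indicator {0<..} \<rho>))) S"
    if "S \<in> range atMost" for S
  proof -
    from that obtain x where S: "S = {..x}" by auto
    have "emeasure (density lborel (\<lambda>\<rho>. V * (ennreal (k * \<rho> powr (k - 1)) * indicator {0<..} \<rho>))) S
      = (\<integral>\<^sup>+\<rho>. V * (ennreal (k * \<rho> powr (k - 1)) * indicator {0<..x} \<rho>) \<partial>lborel)"
      unfolding S by (subst emeasure_density) (auto intro!: nn_integral_cong simp: indicator_def)
    also have "\<dots> = V * (\<integral>\<^sup>+\<rho>. ennreal (k * \<rho> powr (k - 1)) * indicator {0<..x} \<rho> \<partial>lborel)"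
      by (intro nn_integral_cmult) auto
    also have "\<dots> = (if x > 0 then V * ennreal (x powr k) else 0)"
      using nn_integral_power_density[OF k, of x] by auto
    finally show ?thesis using L[of x] S by simp
  qed
  show "emeasure (distr (density lborel F) borel Q) {..real i} \<noteq> \<infinity>" for i
    using V(2) by (auto simp: L ennreal_mult_eq_top_iff)
  show "sets (distr (density lborel F) borel Q) = sigma_sets UNIV (range atMost)"
    by (simp add: borel_eq_atMost)
  show "sets (density lborel (\<lambda>\<rho>. V * (ennreal (k * \<rho> powr (k - 1)) * indicator {0<..} \<rho>)))
      = sigma_sets UNIV (range atMost)"
    by (simp add: borel_eq_atMost)
  show "(\<Union>i. {..real i}) = UNIV"
    using real_arch_simple by auto
qed (auto simp: Int_stable_def)

lemma nn_integral_homogeneous_times_radial_ball: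
  fixes F :: "'a::euclidean_space \<Rightarrow> ennreal" and Q :: "'a \<Rightarrow> real" and h :: "real \<Rightarrow> ennreal"
  assumes [measurable]: "F \<in> borel_measurable borel" "Q \<in> borel_measurable borel"
      "h \<in> borel_measurable borel"
    and p: "p > 0" and dim: "real DIM('a) + d > 0"
    and F: "\<And>c y. c > 0 \<Longrightarrow> F (c *\<^sub>R y) = ennreal (c powr d) * F y"
    and Q: "\<And>c y. c > 0 \<Longrightarrow> Q (c *\<^sub>R y) = c powr p * Q y"
    and Qpos: "\<And>y. y \<noteq> 0 \<Longrightarrow> Q y > 0"
    and V: "(\<integral>\<^sup>+y. F y * indicator {y. Q y \<le> 1} y \<partial>lborel) = V" "V < \<infinity>"
  defines "k \<equiv> (real DIM('a) + d) / p"
  shows "(\<integral>\<^sup>+y. F y * h (Q y) \<partial>lborel)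
     = V * ennreal k * (\<integral>\<^sup>+\<rho>. ennreal (\<rho> powr (k - 1)) * indicator {0<..} \<rho> * h \<rho> \<partial>lborel)"
proof -
  have k: "k > 0" using p dim by (simp add: k_def)
  have "(\<integral>\<^sup>+y. F y * h (Q y) \<partial>lborel) = (\<integral>\<^sup>+\<rho>. h \<rho> \<partial>distr (density lborel F) borel Q)"
    by (simp add: nn_integral_distr nn_integral_density)
  also have "distr (density lborel F) borel Q
     = density lborel (\<lambda>\<rho>. V * (ennreal (k * \<rho> powr (k - 1)) * indicator {0<..} \<rho>))"
    unfolding k_def by (intro distr_homogeneous_density p dim F Q Qpos V) auto
  also have "(\<integral>\<^sup>+\<rho>. h \<rho> \<partial>\<dots>)
      = (\<integral>\<^sup>+\<rho>. (V * ennreal k) * (ennreal (\<rho> powr (k - 1)) * indicator {0<..} \<rho> * h \<rho>) \<partial>lborel)"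
    using k by (subst nn_integral_density) (auto simp: ennreal_mult ac_simps)
  finally show ?thesis by (simp add: nn_integral_cmult)
qed

lemma nn_integral_Gamma:
  assumes "k > (0::real)"
  shows "(\<integral>\<^sup>+\<rho>. ennreal (\<rho> powr (k - 1)) * indicator {0<..} \<rho> * ennreal (exp (- \<rho>)) \<partial>lborel)
    = ennreal (Gamma k)"
proof -
  have "(\<integral>\<^sup>+\<rho>. ennreal (\<rho> powr (k - 1)) * indicator {0<..} \<rho> * ennreal (exp (- \<rho>)) \<partial>lborel)
      = (\<integral>\<^sup>+t. ennreal (indicator {0..} t * t powr (k - 1) / exp t) \<partial>lborel)"
    by (intro nn_integral_cong) (auto simp: indicator_def exp_minus field_simps simp flip: ennreal_mult)
  then show ?thesis
    using Gamma_conv_nn_integral_real[OF assms] by simp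
qed

text \<open>
  The mass of the sublevel set at \<open>1\<close>, the constant in the previous formula, is rarely known. Testing
  with \<open>h \<rho> = exp (- \<rho>)\<close> expresses it by a Gaussian-type integral.
\<close>

lemma nn_integral_homogeneous_times_radial:
  fixes F :: "'a::euclidean_space \<Rightarrow> ennreal" and Q :: "'a \<Rightarrow> real" and h :: "real \<Rightarrow> ennreal"
  assumes [measurable]: "F \<in> borel_measurable borel" "Q \<in> borel_measurable borel"
      "h \<in> borel_measurable borel"
    and p: "p > 0" and dim: "real DIM('a) + d > 0"
    and F: "\<And>c y. c > 0 \<Longrightarrow> F (c *\<^sub>R y) = ennreal (c powr d) * F y"
    and Q: "\<And>c y. c > 0 \<Longrightarrow> Q (c *\<^sub>R y) = c powr p * Q y"
    and Qpos: "\<And>y. y \<noteq> 0 \<Longrightarrow> Q y > 0"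
    and V: "(\<integral>\<^sup>+y. F y * indicator {y. Q y \<le> 1} y \<partial>lborel) < \<infinity>"
  defines "k \<equiv> (real DIM('a) + d) / p"
  shows "ennreal (Gamma k) * (\<integral>\<^sup>+y. F y * h (Q y) \<partial>lborel)
     = (\<integral>\<^sup>+y. F y * ennreal (exp (- Q y)) \<partial>lborel) *
       (\<integral>\<^sup>+\<rho>. ennreal (\<rho> powr (k - 1)) * indicator {0<..} \<rho> * h \<rho> \<partial>lborel)"
    and "(\<integral>\<^sup>+y. F y * ennreal (exp (- Q y)) \<partial>lborel) < \<infinity>"
proof -
  define V where "V = (\<integral>\<^sup>+y. F y * indicator {y. Q y \<le> 1} y \<partial>lborel)"
  have Vfin: "V < \<infinity>" using V by (simp add: V_def)
  have k: "k > 0" using p dim by (simp add: k_def)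
  note radial = nn_integral_homogeneous_times_radial_ball
    [OF _ _ _ p dim F Q Qpos V_def[symmetric] Vfin, folded k_def]
  have G: "(\<integral>\<^sup>+y. F y * ennreal (exp (- Q y)) \<partial>lborel) = V * ennreal k * ennreal (Gamma k)"
    unfolding nn_integral_Gamma[OF k, symmetric] by (rule radial) auto
  have "(\<integral>\<^sup>+y. F y * h (Q y) \<partial>lborel)
     = V * ennreal k * (\<integral>\<^sup>+\<rho>. ennreal (\<rho> powr (k - 1)) * indicator {0<..} \<rho> * h \<rho> \<partial>lborel)"
    by (rule radial) auto
  then show "ennreal (Gamma k) * (\<integral>\<^sup>+y. F y * h (Q y) \<partial>lborel)
     = (\<integral>\<^sup>+y. F y * ennreal (exp (- Q y)) \<partial>lborel) *
       (\<integral>\<^sup>+\<rho>. ennreal (\<rho> powr (k - 1)) * indicator {0<..} \<rho> * h \<rho> \<partial>lborel)"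
    by (simp add: G ac_simps)
  show "(\<integral>\<^sup>+y. F y * ennreal (exp (- Q y)) \<partial>lborel) < \<infinity>"
    using Vfin by (simp add: G ennreal_mult_less_top)
qed

text \<open>
  The substitution \<open>x = b * \<rho> powr s\<close>, obtained from the homogeneity of \<open>b * \<bar>\<rho>\<bar> powr s\<close> on the real
  line; the weight vanishes on the negative half-line, so the absolute value does not matter.
\<close>

lemma nn_integral_powr_substitution:
  fixes b s \<sigma> :: real
  assumes [measurable]: "h \<in> borel_measurable borel" and b: "b > 0" and s: "s > 0" and \<sigma>: "\<sigma> > 0"
  shows "(\<integral>\<^sup>+\<rho>. ennreal (\<rho> powr (\<sigma> * s - 1)) * indicator {0<..} \<rho> * h (b * \<rho> powr s) \<partial>lborel)
    = ennreal (b powr (- \<sigma>) / s) *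
      (\<integral>\<^sup>+x. ennreal (x powr (\<sigma> - 1)) * indicator {0<..} x * h x \<partial>lborel)"
proof -
  define F where "F = (\<lambda>\<rho>. ennreal (\<rho> powr (\<sigma> * s - 1)) * indicator {0<..} \<rho>)"
  \<comment> \<open>\<open>R\<close> is the point where \<open>b * \<rho> powr s\<close> reaches \<open>1\<close>.\<close>
  define R where "R = b powr (- 1 / s)"
  have \<sigma>s: "\<sigma> * s > 0" using \<sigma> s by simp
  have R: "b * \<rho> powr s \<le> 1 \<longleftrightarrow> \<rho> \<le> R" if "\<rho> > 0" for \<rho>
  proof -
    have "b * R powr s = 1" "R > 0"
      using b s powr_add[of b 1 "-1"] by (simp_all add: R_def powr_powr)
    then have "b * \<rho> powr s \<le> 1 \<longleftrightarrow> \<rho> powr s \<le> R powr s"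
      using b by (metis mult_le_cancel_left_pos)
    also have "\<dots> \<longleftrightarrow> \<rho> \<le> R"
      using s that \<open>R > 0\<close> powr_mono2[of s \<rho> R] powr_less_mono2[of s R \<rho>] by fastforce
    finally show ?thesis .
  qed
  have V: "(\<integral>\<^sup>+\<rho>. F \<rho> * indicator {\<rho>. b * \<bar>\<rho>\<bar> powr s \<le> 1} \<rho> \<partial>lborel) = ennreal (b powr (- \<sigma>) / (\<sigma> * s))"
  proof -
    have "(\<integral>\<^sup>+\<rho>. F \<rho> * indicator {\<rho>. b * \<bar>\<rho>\<bar> powr s \<le> 1} \<rho> \<partial>lborel)
      = (\<integral>\<^sup>+\<rho>. ennreal (1 / (\<sigma> * s)) * (ennreal (\<sigma> * s * \<rho> powr (\<sigma> * s - 1)) * indicator {0<..R} \<rho>) \<partial>lborel)"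
      using \<sigma> s R by (intro nn_integral_cong) (auto simp: F_def indicator_def simp flip: ennreal_mult)
    also have "\<dots> = ennreal (1 / (\<sigma> * s)) * ennreal (R powr (\<sigma> * s))"
      using nn_integral_power_density[OF \<sigma>s, of R] by (subst nn_integral_cmult) (auto simp: R_def)
    also have "R powr (\<sigma> * s) = b powr (- \<sigma>)"
      using s by (simp add: R_def powr_powr)
    finally show ?thesis using \<sigma>s by (simp flip: ennreal_mult)
  qed
  have "(\<integral>\<^sup>+\<rho>. ennreal (\<rho> powr (\<sigma> * s - 1)) * indicator {0<..} \<rho> * h (b * \<rho> powr s) \<partial>lborel)
    = (\<integral>\<^sup>+\<rho>. F \<rho> * h (b * \<bar>\<rho>\<bar> powr s) \<partial>lborel)"
    by (intro nn_integral_cong) (auto simp: F_def indicator_def)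
  also have "\<dots> = ennreal (b powr (- \<sigma>) / (\<sigma> * s)) * ennreal ((real DIM(real) + (\<sigma> * s - 1)) / s) *
     (\<integral>\<^sup>+x. ennreal (x powr ((real DIM(real) + (\<sigma> * s - 1)) / s - 1)) * indicator {0<..} x * h x \<partial>lborel)"
  proof (rule nn_integral_homogeneous_times_radial_ball[OF _ _ _ s _ _ _ _ V])
    show "F (c *\<^sub>R y) = ennreal (c powr (\<sigma> * s - 1)) * F y" if "c > 0" for c y
      using that by (auto simp: F_def indicator_def powr_mult zero_less_mult_iff simp flip: ennreal_mult)
    show "b * \<bar>c *\<^sub>R y\<bar> powr s = c powr s * (b * \<bar>y\<bar> powr s)" if "c > 0" for c y
      using that by (simp add: abs_mult powr_mult)
  qed (use b \<sigma>s in \<open>auto simp: F_def\<close>)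
  also have "(real DIM(real) + (\<sigma> * s - 1)) / s = \<sigma>" using s by simp
  also have "ennreal (b powr (- \<sigma>) / (\<sigma> * s)) * ennreal \<sigma> = ennreal (b powr (- \<sigma>) / s)"
    using \<sigma> s by (simp flip: ennreal_mult)
  finally show ?thesis .
qed

lemma nn_integral_stretched_Gamma:
  assumes "a > 0" "s > 0" "\<sigma> > (0::real)"
  shows "(\<integral>\<^sup>+\<rho>. ennreal (\<rho> powr (\<sigma> * s - 1)) * indicator {0<..} \<rho> * ennreal (exp (- (a * \<rho> powr s))) \<partial>lborel)
    = ennreal (a powr (- \<sigma>) / s * Gamma \<sigma>)"
  using assms Gamma_real_pos[of \<sigma>] nn_integral_powr_substitution[of "\<lambda>x. ennreal (exp (- x))" a s \<sigma>]
  by (simp add: nn_integral_Gamma flip: ennreal_mult)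

section \<open>The quadratic form of the inverse of a positive definite matrix\<close>

definition mahalanobis_sq :: "real ^ 'n ^ 'n \<Rightarrow> real ^ 'n \<Rightarrow> real" where
  "mahalanobis_sq \<Sigma> y = y \<bullet> (matrix_inv \<Sigma> *v y)"

lemma continuous_mahalanobis_sq [continuous_intros]: "continuous_on A (mahalanobis_sq \<Sigma>)"
  unfolding mahalanobis_sq_def
  by (intro continuous_intros linear_continuous_on) (simp add: linear_linear)

lemma mahalanobis_sq_measurable [measurable]: "mahalanobis_sq \<Sigma> \<in> borel_measurable borel"
  by (intro borel_measurable_continuous_onI continuous_intros)

lemma mahalanobis_sq_scaleR: "mahalanobis_sq \<Sigma> (c *\<^sub>R y) = c\<^sup>2 * mahalanobis_sq \<Sigma> y"
  by (simp add: mahalanobis_sq_def matrix_vector_mult_scaleR power2_eq_square)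

lemma pos_def_matrix_inner_commute:
  assumes "pos_def_matrix \<Sigma>"
  shows "(\<Sigma> *v x) \<bullet> y = x \<bullet> (\<Sigma> *v y)"
proof -
  have "transpose \<Sigma> *v x = \<Sigma> *v x"
    using assms by (simp only: pos_def_matrix_def)
  then have "\<Sigma> *v x = x v* \<Sigma>" by simp
  then show ?thesis by (simp only: dot_lmul_matrix)
qed

lemma pos_def_matrix_inner_nonneg: "pos_def_matrix \<Sigma> \<Longrightarrow> t \<bullet> (\<Sigma> *v t) \<ge> 0"
  by (cases "t = 0") (auto simp: pos_def_matrix_def intro: less_imp_le)

lemma pos_def_matrix_invertible:
  assumes "pos_def_matrix \<Sigma>"
  shows "invertible \<Sigma>"
proof -
  have "x = 0" if "\<Sigma> *v x = 0" for x
    using assms that unfolding pos_def_matrix_def by (metis inner_zero_right less_irrefl)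
  then have "\<exists>B. B ** \<Sigma> = mat 1" by (subst matrix_left_invertible_ker) auto
  then show ?thesis by (auto simp: invertible_left_inverse)
qed

lemma matrix_inv_mult_vec:
  fixes \<Sigma> :: "real ^ 'n ^ 'n"
  assumes "invertible \<Sigma>"
  shows "matrix_inv \<Sigma> *v (\<Sigma> *v x) = x" "\<Sigma> *v (matrix_inv \<Sigma> *v x) = x"
proof -
  have "\<Sigma> ** matrix_inv \<Sigma> = mat 1 \<and> matrix_inv \<Sigma> ** \<Sigma> = mat 1"
    using assms unfolding invertible_def matrix_inv_def by (rule someI_ex)
  then show "matrix_inv \<Sigma> *v (\<Sigma> *v x) = x" "\<Sigma> *v (matrix_inv \<Sigma> *v x) = x"
    by (auto simp: matrix_vector_mul_assoc)
qed

context
  fixes \<Sigma> :: "real ^ 'n ^ 'n"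
  assumes pd: "pos_def_matrix \<Sigma>"
begin

lemma mahalanobis_sq_pos: "y \<noteq> 0 \<Longrightarrow> mahalanobis_sq \<Sigma> y > 0"
proof -
  assume "y \<noteq> 0"
  define z where "z = matrix_inv \<Sigma> *v y"
  have y: "y = \<Sigma> *v z"
    unfolding z_def by (simp add: matrix_inv_mult_vec pos_def_matrix_invertible pd)
  with \<open>y \<noteq> 0\<close> have "z \<noteq> 0" by auto
  then have "z \<bullet> (\<Sigma> *v z) > 0" using pd by (simp add: pos_def_matrix_def)
  moreover have "mahalanobis_sq \<Sigma> y = (\<Sigma> *v z) \<bullet> z"
    unfolding mahalanobis_sq_def z_def[symmetric] using y by simp
  ultimately show ?thesis by (simp add: inner_commute)
qed

lemma mahalanobis_sq_nonneg: "mahalanobis_sq \<Sigma> y \<ge> 0"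
  using mahalanobis_sq_pos[of y] by (cases "y = 0") (auto simp: mahalanobis_sq_def)

text \<open>
  This is the completion of the square: a translation along \<open>\<Sigma> *v t\<close> produces the linear
  functional \<open>t \<bullet> y\<close>, because \<open>matrix_inv \<Sigma>\<close> undoes \<open>\<Sigma>\<close>.
\<close>

lemma mahalanobis_sq_shift:
  "mahalanobis_sq \<Sigma> (y + c *\<^sub>R (\<Sigma> *v t)) = mahalanobis_sq \<Sigma> y + 2 * c * (t \<bullet> y) + c\<^sup>2 * (t \<bullet> (\<Sigma> *v t))"
proof -
  have "(\<Sigma> *v t) \<bullet> (matrix_inv \<Sigma> *v y) = t \<bullet> y"
    by (simp add: pos_def_matrix_inner_commute pd matrix_inv_mult_vec pos_def_matrix_invertible)
  moreover have "(\<Sigma> *v t) \<bullet> t = t \<bullet> (\<Sigma> *v t)" by (rule inner_commute)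
  ultimately show ?thesis
    by (simp add: mahalanobis_sq_def matrix_vector_right_distrib matrix_vector_mult_scaleR
        matrix_inv_mult_vec pos_def_matrix_invertible pd inner_add_left inner_add_right
        power2_eq_square algebra_simps inner_commute[of y t])
qed

text \<open>
  The Cauchy-Schwarz inequality for the form of \<open>\<Sigma>\<close> and its dual. The quadratic polynomial in \<open>c\<close>
  on the right of \<open>mahalanobis_sq_shift\<close> is a value of the form, hence nonnegative also at its minimum.
\<close>

lemma inner_square_le_mahalanobis_sq: "(t \<bullet> y)\<^sup>2 \<le> (t \<bullet> (\<Sigma> *v t)) * mahalanobis_sq \<Sigma> y"
proof (cases "t = 0")
  case False
  define u where "u = t \<bullet> (\<Sigma> *v t)"
  have u: "u > 0" using pd False by (simp add: u_def pos_def_matrix_def)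
  \<comment> \<open>The coefficient \<open>- (t \<bullet> y) / u\<close> minimizes the quadratic polynomial.\<close>
  have "0 \<le> mahalanobis_sq \<Sigma> (y + (- (t \<bullet> y) / u) *\<^sub>R (\<Sigma> *v t))" by (rule mahalanobis_sq_nonneg)
  also have "\<dots> = mahalanobis_sq \<Sigma> y - (t \<bullet> y)\<^sup>2 / u"
    unfolding mahalanobis_sq_shift u_def[symmetric] using u
    by (simp add: field_simps power2_eq_square)
  finally show ?thesis using u by (simp add: u_def field_simps)
qed simp

text \<open>
  The previous inequality, applied to the basis vectors in place of \<open>t\<close>, bounds every coordinate.
\<close>

lemma bounded_mahalanobis_sq_ball: "bounded {y. mahalanobis_sq \<Sigma> y \<le> 1}"
proof (rule boundedI)
  fix y assume "y \<in> {y. mahalanobis_sq \<Sigma> y \<le> 1}"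
  then have y: "mahalanobis_sq \<Sigma> y \<le> 1" by simp
  have "\<bar>y \<bullet> b\<bar> \<le> sqrt (b \<bullet> (\<Sigma> *v b))" if "b \<in> Basis" for b
  proof -
    have b: "b \<bullet> (\<Sigma> *v b) \<ge> 0"
      using pd by (rule pos_def_matrix_inner_nonneg)
    have "(b \<bullet> y)\<^sup>2 \<le> (b \<bullet> (\<Sigma> *v b)) * mahalanobis_sq \<Sigma> y" by (rule inner_square_le_mahalanobis_sq)
    also have "\<dots> \<le> b \<bullet> (\<Sigma> *v b)" using mult_left_mono[OF y b] by simp
    finally show ?thesis by (subst inner_commute) (rule real_le_rsqrt, simp)
  qed
  then have "(\<Sum>b\<in>Basis. \<bar>y \<bullet> b\<bar>) \<le> (\<Sum>b\<in>Basis. sqrt (b \<bullet> (\<Sigma> *v b)))" by (intro sum_mono)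
  then show "norm y \<le> (\<Sum>b\<in>Basis. sqrt (b \<bullet> (\<Sigma> *v b)))"
    using norm_le_l1[of y] by linarith
qed

lemma inner_power_mahalanobis_sq_ball_finite:
  "(\<integral>\<^sup>+y. ennreal ((t \<bullet> y) ^ (2 * j)) * indicator {y. mahalanobis_sq \<Sigma> y \<le> 1} y \<partial>lborel) < \<infinity>"
proof -
  define u where "u = t \<bullet> (\<Sigma> *v t)"
  have u: "u \<ge> 0" using pd by (simp add: u_def pos_def_matrix_inner_nonneg)
  have "(\<integral>\<^sup>+y. ennreal ((t \<bullet> y) ^ (2 * j)) * indicator {y. mahalanobis_sq \<Sigma> y \<le> 1} y \<partial>lborel)
      \<le> (\<integral>\<^sup>+y. ennreal (u ^ j) * indicator {y. mahalanobis_sq \<Sigma> y \<le> 1} y \<partial>lborel)"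
  proof (intro nn_integral_mono)
    fix y :: "real ^ 'n"
    have "(t \<bullet> y) ^ (2 * j) \<le> u ^ j" if "mahalanobis_sq \<Sigma> y \<le> 1"
    proof -
      have "(t \<bullet> y)\<^sup>2 \<le> u * mahalanobis_sq \<Sigma> y"
        using inner_square_le_mahalanobis_sq unfolding u_def .
      also have "\<dots> \<le> u" using mult_left_mono[OF that u] by simp
      finally show ?thesis unfolding power_mult by (intro power_mono) auto
    qed
    then show "ennreal ((t \<bullet> y) ^ (2 * j)) * indicator {y. mahalanobis_sq \<Sigma> y \<le> 1} y
        \<le> ennreal (u ^ j) * indicator {y. mahalanobis_sq \<Sigma> y \<le> 1} y"
      by (auto simp: indicator_def intro!: ennreal_leI)
  qed
  also have "\<dots> = ennreal (u ^ j) * emeasure lborel {y. mahalanobis_sq \<Sigma> y \<le> 1}"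
    by (intro nn_integral_cmult_indicator) measurable
  also have "\<dots> < \<infinity>"
    using emeasure_bounded_finite[OF bounded_mahalanobis_sq_ball]
    by (auto simp: ennreal_mult_less_top)
  finally show ?thesis .
qed

lemma nn_integral_inner_power_radial:
  fixes t :: "real ^ 'n" and j :: nat
  assumes [measurable]: "h \<in> borel_measurable borel"
  defines "k \<equiv> real CARD('n) / 2 + real j"
  shows "ennreal (Gamma k) * (\<integral>\<^sup>+y. ennreal ((t \<bullet> y) ^ (2 * j)) * h (mahalanobis_sq \<Sigma> y) \<partial>lborel)
     = (\<integral>\<^sup>+y. ennreal ((t \<bullet> y) ^ (2 * j)) * ennreal (exp (- mahalanobis_sq \<Sigma> y)) \<partial>lborel) *
       (\<integral>\<^sup>+\<rho>. ennreal (\<rho> powr (k - 1)) * indicator {0<..} \<rho> * h \<rho> \<partial>lborel)"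
    and "(\<integral>\<^sup>+y. ennreal ((t \<bullet> y) ^ (2 * j)) * ennreal (exp (- mahalanobis_sq \<Sigma> y)) \<partial>lborel) < \<infinity>"
proof -
  have k: "k = (real DIM(real ^ 'n) + real (2 * j)) / 2" by (simp add: k_def field_simps)
  have F: "ennreal ((t \<bullet> (c *\<^sub>R y)) ^ (2 * j))
      = ennreal (c powr real (2 * j)) * ennreal ((t \<bullet> y) ^ (2 * j))" if "c > 0" for c y
    using that by (simp add: power_mult_distrib powr_realpow flip: ennreal_mult del: of_nat_mult)
  have Q: "mahalanobis_sq \<Sigma> (c *\<^sub>R y) = c powr 2 * mahalanobis_sq \<Sigma> y" if "c > 0" for c y
    using that by (simp add: mahalanobis_sq_scaleR)
  note * = nn_integral_homogeneous_times_radial[where F = "\<lambda>y. ennreal ((t \<bullet> y) ^ (2 * j))"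
      and Q = "mahalanobis_sq \<Sigma>" and h = h and d = "real (2 * j)" and p = 2,
      OF _ _ _ _ _ F Q mahalanobis_sq_pos inner_power_mahalanobis_sq_ball_finite, folded k]
  show "ennreal (Gamma k) * (\<integral>\<^sup>+y. ennreal ((t \<bullet> y) ^ (2 * j)) * h (mahalanobis_sq \<Sigma> y) \<partial>lborel)
     = (\<integral>\<^sup>+y. ennreal ((t \<bullet> y) ^ (2 * j)) * ennreal (exp (- mahalanobis_sq \<Sigma> y)) \<partial>lborel) *
       (\<integral>\<^sup>+\<rho>. ennreal (\<rho> powr (k - 1)) * indicator {0<..} \<rho> * h \<rho> \<partial>lborel)"
    by (rule *(1)) (auto intro: add_pos_nonneg)
  show "(\<integral>\<^sup>+y. ennreal ((t \<bullet> y) ^ (2 * j)) * ennreal (exp (- mahalanobis_sq \<Sigma> y)) \<partial>lborel) < \<infinity>"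
    by (rule *(2)) (auto intro: add_pos_nonneg)
qed

text \<open>
  The translation of \<open>y\<close> by \<open>(\<tau> / 2) *\<^sub>R (\<Sigma> *v t)\<close> absorbs the linear term.
\<close>

lemma nn_integral_exp_inner_gaussian:
  "(\<integral>\<^sup>+y. ennreal (exp (\<tau> * (t \<bullet> y))) * ennreal (exp (- mahalanobis_sq \<Sigma> y)) \<partial>lborel)
   = ennreal (exp (\<tau>\<^sup>2 * (t \<bullet> (\<Sigma> *v t)) / 4)) * (\<integral>\<^sup>+y. ennreal (exp (- mahalanobis_sq \<Sigma> y)) \<partial>lborel)"
proof -
  define w where "w = (\<tau> / 2) *\<^sub>R (\<Sigma> *v t)"
  have "(\<integral>\<^sup>+y. ennreal (exp (\<tau> * (t \<bullet> y))) * ennreal (exp (- mahalanobis_sq \<Sigma> y)) \<partial>lborel)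
    = (\<integral>\<^sup>+y. ennreal (exp (\<tau> * (t \<bullet> y))) * ennreal (exp (- mahalanobis_sq \<Sigma> y)) \<partial>distr lborel borel ((+) w))"
    by (simp add: lborel_distr_plus)
  also have "\<dots> = (\<integral>\<^sup>+y. ennreal (exp (\<tau> * (t \<bullet> (w + y)))) * ennreal (exp (- mahalanobis_sq \<Sigma> (w + y))) \<partial>lborel)"
    by (subst nn_integral_distr) auto
  also have "\<dots> = (\<integral>\<^sup>+y. ennreal (exp (\<tau>\<^sup>2 * (t \<bullet> (\<Sigma> *v t)) / 4)) *
       ennreal (exp (- mahalanobis_sq \<Sigma> y)) \<partial>lborel)"
  proof (intro nn_integral_cong)
    fix y
    have "\<tau> * (t \<bullet> (w + y)) - mahalanobis_sq \<Sigma> (w + y)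
      = \<tau>\<^sup>2 * (t \<bullet> (\<Sigma> *v t)) / 4 - mahalanobis_sq \<Sigma> y"
      unfolding add.commute[of w y] unfolding w_def mahalanobis_sq_shift
      by (simp add: inner_add_right field_simps power2_eq_square)
    then have "exp (\<tau> * (t \<bullet> (w + y))) * exp (- mahalanobis_sq \<Sigma> (w + y))
      = exp (\<tau>\<^sup>2 * (t \<bullet> (\<Sigma> *v t)) / 4) * exp (- mahalanobis_sq \<Sigma> y)"
      by (simp flip: exp_add)
    then show "ennreal (exp (\<tau> * (t \<bullet> (w + y)))) * ennreal (exp (- mahalanobis_sq \<Sigma> (w + y)))
      = ennreal (exp (\<tau>\<^sup>2 * (t \<bullet> (\<Sigma> *v t)) / 4)) * ennreal (exp (- mahalanobis_sq \<Sigma> y))"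
      by (simp flip: ennreal_mult)
  qed
  also have "\<dots> = ennreal (exp (\<tau>\<^sup>2 * (t \<bullet> (\<Sigma> *v t)) / 4)) *
      (\<integral>\<^sup>+y. ennreal (exp (- mahalanobis_sq \<Sigma> y)) \<partial>lborel)"
    by (intro nn_integral_cmult) auto
  finally show ?thesis .
qed

end

section \<open>Even moments of the Gaussian weight\<close>

text \<open>
  The expansions of the Gaussian moment generating function are known only at \<open>x = \<tau>\<^sup>2 \<ge> 0\<close>, hence
  equality is assumed on the half-line only. A power series whose sum vanishes there
  has a non-isolated zero at the origin and is therefore zero.
\<close>

lemma powser_coeffs_unique:
  fixes a b :: "nat \<Rightarrow> real"
  assumes a: "\<And>x. x \<ge> 0 \<Longrightarrow> (\<lambda>n. a n * x ^ n) sums f x"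
      and b: "\<And>x. x \<ge> 0 \<Longrightarrow> (\<lambda>n. b n * x ^ n) sums f x"
  shows "a m = b m"
proof (rule ccontr)
  assume neq: "a m \<noteq> b m"
  define d where "d = (\<lambda>n. a n - b n)"
  have d0: "(\<lambda>n. d n * x ^ n) sums 0" if "x \<ge> 0" for x
    using sums_diff[OF a b, OF that that] by (simp add: d_def algebra_simps)
  have sm: "(\<lambda>n. d n * (x - 0) ^ n) sums (\<Sum>n. d n * x ^ n)" for x
  proof -
    have "summable (\<lambda>n. d n * x ^ n)"
      using sums_summable[OF d0[of "\<bar>x\<bar> + 1"]] by (rule powser_inside) auto
    then show ?thesis by (simp add: summable_sums)
  qed
  have zero: "(\<Sum>n. d n * x ^ n) = 0" if "x \<ge> 0" for x
    using d0[OF that] by (rule sums_unique[symmetric])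
  have "d 0 = 0"
    using zero[of 0] by (simp add: powser_zero)
  then have "m > 0" using neq by (cases m) (auto simp: d_def)
  with neq obtain e where e: "e > 0" "\<And>z. z \<in> cball 0 e - {0} \<Longrightarrow> (\<Sum>n. d n * z ^ n) \<noteq> 0"
    using powser_0_nonzero[of 1 0 d "\<lambda>x. \<Sum>n. d n * x ^ n" m] sm zero[of 0] by (auto simp: d_def)
  then show False using zero[of e] by auto
qed

lemma cosh_paired: "(\<lambda>n. x ^ (2 * n) / fact (2 * n)) sums cosh (x::real)"
proof -
  have "(\<lambda>n. (if even (2 * n) then x ^ (2 * n) /\<^sub>R fact (2 * n) else 0)) sums cosh x"
    using cosh_converges[of x]
    by (subst sums_mono_reindex[where g = "\<lambda>n. 2 * n"]) (auto simp: strict_mono_def elim!: evenE)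
  then show ?thesis by (simp add: divide_inverse mult.commute)
qed

lemma fact_double_Gamma:
  "fact (2 * j) / (4 ^ j * fact j) = Gamma (real j + 1 / 2) / sqrt pi"
proof (induction j)
  case (Suc j)
  have "Gamma (real (Suc j) + 1 / 2) = (real j + 1 / 2) * Gamma (real j + 1 / 2)"
    using Gamma_plus1[of "real j + 1 / 2"] by (simp add: nonpos_Ints_def add_ac)
  moreover have "fact (2 * Suc j) / (4 ^ Suc j * fact (Suc j))
     = (real j + 1 / 2) * (fact (2 * j) / (4 ^ j * fact j) :: real)"
    by (simp add: divide_simps) (simp add: algebra_simps)
  ultimately show ?case using Suc by simp
qed (simp add: Gamma_one_half_real)

text \<open>
  The moment generating function of the Gaussian weight is, as a function of \<open>\<tau>\<^sup>2\<close>, an exponential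
  series. Integrating the series of \<open>cosh (\<tau> * (t \<bullet> y))\<close> term by term gives a second expansion whose
  coefficients are the even moments, and the two agree coefficientwise. The factor
  \<open>fact (2 * j) / (4 ^ j * fact j)\<close> that comes out is a quotient of Gamma values.
\<close>

lemma nn_integral_inner_power_gaussian:
  fixes \<Sigma> :: "real ^ 'n ^ 'n" and t :: "real ^ 'n" and j :: nat
  assumes pd: "pos_def_matrix \<Sigma>"
  shows "(\<integral>\<^sup>+y. ennreal ((t \<bullet> y) ^ (2 * j)) * ennreal (exp (- mahalanobis_sq \<Sigma> y)) \<partial>lborel)
    = ennreal ((t \<bullet> (\<Sigma> *v t)) ^ j * (Gamma (real j + 1 / 2) / sqrt pi)) *
      (\<integral>\<^sup>+y. ennreal (exp (- mahalanobis_sq \<Sigma> y)) \<partial>lborel)"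
proof -
  define u where "u = t \<bullet> (\<Sigma> *v t)"
  have u: "u \<ge> 0" using pd by (simp add: u_def pos_def_matrix_inner_nonneg)
  define G where "G = (\<lambda>j. \<integral>\<^sup>+y. ennreal ((t \<bullet> y) ^ (2 * j)) * ennreal (exp (- mahalanobis_sq \<Sigma> y)) \<partial>lborel)"
  define g where "g = (\<lambda>j. enn2real (G j))"
  have G: "G j = ennreal (g j)" for j
    using nn_integral_inner_power_radial(2)[OF pd, of "\<lambda>_. 0" t j] by (simp add: G_def g_def)
  have g: "g j \<ge> 0" for j by (simp add: g_def)
  have G0: "(\<integral>\<^sup>+y. ennreal (exp (- mahalanobis_sq \<Sigma> y)) \<partial>lborel) = ennreal (g 0)"
    using G[of 0] by (simp add: G_def)
  \<comment> \<open>Averaging the exponential identity over \<open>\<tau>\<close> and \<open>- \<tau>\<close> leaves the even powers only.\<close>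
  have cosh_eq: "(\<integral>\<^sup>+y. ennreal (cosh (\<tau> * (t \<bullet> y))) * ennreal (exp (- mahalanobis_sq \<Sigma> y)) \<partial>lborel)
     = ennreal (exp (\<tau>\<^sup>2 * u / 4) * g 0)" for \<tau>
  proof -
    define h :: real where "h = 1 / 2"
    have h: "h \<ge> 0" by (simp add: h_def)
    have "cosh (\<tau> * (t \<bullet> y)) * exp (- mahalanobis_sq \<Sigma> y)
      = h * (exp (\<tau> * (t \<bullet> y)) * exp (- mahalanobis_sq \<Sigma> y)
           + exp ((- \<tau>) * (t \<bullet> y)) * exp (- mahalanobis_sq \<Sigma> y))" for y
      by (simp add: cosh_def h_def field_simps)
    then have "(\<integral>\<^sup>+y. ennreal (cosh (\<tau> * (t \<bullet> y))) * ennreal (exp (- mahalanobis_sq \<Sigma> y)) \<partial>lborel)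
     = (\<integral>\<^sup>+y. ennreal h * (ennreal (exp (\<tau> * (t \<bullet> y))) * ennreal (exp (- mahalanobis_sq \<Sigma> y))
            + ennreal (exp ((- \<tau>) * (t \<bullet> y))) * ennreal (exp (- mahalanobis_sq \<Sigma> y))) \<partial>lborel)"
      using h by (intro nn_integral_cong) (simp flip: ennreal_mult ennreal_plus)
    also have "\<dots> = ennreal h * (ennreal (exp (\<tau>\<^sup>2 * u / 4)) * ennreal (g 0)
        + ennreal (exp ((-\<tau>)\<^sup>2 * u / 4)) * ennreal (g 0))"
      unfolding G0[symmetric] u_def nn_integral_exp_inner_gaussian[OF pd, symmetric]
      by (subst nn_integral_cmult, simp) (subst nn_integral_add, auto)
    also have "\<dots> = ennreal (exp (\<tau>\<^sup>2 * u / 4) * g 0)"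
      using g[of 0] h by (simp flip: ennreal_mult ennreal_plus) (simp add: h_def)
    finally show ?thesis .
  qed
  have 1: "(\<lambda>n. g n / fact (2 * n) * x ^ n) sums (exp (x * u / 4) * g 0)" if "x \<ge> 0" for x
  proof -
    have nn: "0 \<le> g n / fact (2 * n) * x ^ n" for n using g that by simp
    have "(\<integral>\<^sup>+y. ennreal (cosh (sqrt x * (t \<bullet> y))) * ennreal (exp (- mahalanobis_sq \<Sigma> y)) \<partial>lborel)
      = (\<integral>\<^sup>+y. (\<Sum>n. ennreal (x ^ n / fact (2 * n)) *
          (ennreal ((t \<bullet> y) ^ (2 * n)) * ennreal (exp (- mahalanobis_sq \<Sigma> y)))) \<partial>lborel)"
    proof (intro nn_integral_cong)
      fix y
      have "(\<lambda>n. ennreal ((sqrt x * (t \<bullet> y)) ^ (2 * n) / fact (2 * n) * exp (- mahalanobis_sq \<Sigma> y)))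
          sums ennreal (cosh (sqrt x * (t \<bullet> y)) * exp (- mahalanobis_sq \<Sigma> y))"
        using sums_mult2[OF cosh_paired[of "sqrt x * (t \<bullet> y)"], of "exp (- mahalanobis_sq \<Sigma> y)"] that
        by (subst sums_ennreal) (auto simp: power_mult)
      moreover have "ennreal ((sqrt x * (t \<bullet> y)) ^ (2 * n) / fact (2 * n) * exp (- mahalanobis_sq \<Sigma> y))
        = ennreal (x ^ n / fact (2 * n)) *
          (ennreal ((t \<bullet> y) ^ (2 * n)) * ennreal (exp (- mahalanobis_sq \<Sigma> y)))" for n
      proof -
        have "(sqrt x * (t \<bullet> y)) ^ (2 * n) = x ^ n * (t \<bullet> y) ^ (2 * n)"
          using that by (simp add: power_mult_distrib) (simp add: power_mult)
        then show ?thesis using that by (simp flip: ennreal_mult)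
      qed
      ultimately show "ennreal (cosh (sqrt x * (t \<bullet> y))) * ennreal (exp (- mahalanobis_sq \<Sigma> y))
        = (\<Sum>n. ennreal (x ^ n / fact (2 * n)) *
          (ennreal ((t \<bullet> y) ^ (2 * n)) * ennreal (exp (- mahalanobis_sq \<Sigma> y))))"
        by (simp add: sums_iff ennreal_mult)
    qed
    also have "\<dots> = (\<Sum>n. ennreal (x ^ n / fact (2 * n)) * G n)"
      unfolding G_def by (subst nn_integral_suminf) (auto intro!: suminf_cong nn_integral_cmult)
    also have "\<dots> = (\<Sum>n. ennreal (g n / fact (2 * n) * x ^ n))"
      using that g by (simp add: G field_simps flip: ennreal_mult)
    finally have *: "(\<Sum>n. ennreal (g n / fact (2 * n) * x ^ n)) = ennreal (exp (x * u / 4) * g 0)"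
      using that unfolding cosh_eq by simp
    then have "summable (\<lambda>n. g n / fact (2 * n) * x ^ n)"
      using nn by (intro summable_suminf_not_top) auto
    then show ?thesis
      using * nn g[of 0] by (simp add: suminf_ennreal2 sums_iff suminf_nonneg)
  qed
  have 2: "(\<lambda>n. g 0 * (u / 4) ^ n / fact n * x ^ n) sums (exp (x * u / 4) * g 0)" for x
    using sums_mult[OF exp_converges[of "x * u / 4"], of "g 0"]
    by (simp add: field_simps power_mult_distrib power_divide)
  have "g j / fact (2 * j) = g 0 * (u / 4) ^ j / fact j"
    by (rule powser_coeffs_unique[OF 1 2])
  then have "g j = g 0 * u ^ j * (fact (2 * j) / (4 ^ j * fact j))"
    by (simp add: field_simps power_divide)
  then have "g j = u ^ j * (Gamma (real j + 1 / 2) / sqrt pi) * g 0"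
    unfolding fact_double_Gamma by simp
  moreover have "u ^ j * (Gamma (real j + 1 / 2) / sqrt pi) \<ge> 0"
    using u Gamma_real_pos[of "real j + 1 / 2"] by simp
  ultimately have "ennreal (g j) = ennreal (u ^ j * (Gamma (real j + 1 / 2) / sqrt pi)) * ennreal (g 0)"
    using g[of 0] by (subst ennreal_mult[symmetric]) auto
  then show ?thesis
    using G[of j] unfolding G0 G_def u_def[symmetric] by (simp only:)
qed

section \<open>Expectation of a cosine from even moments\<close>

text \<open>
  Abel's limit theorem: with \<open>R n\<close> the error of the \<open>n\<close>-th partial sum, summation by parts gives
  \<open>(\<Sum>n. a n * x ^ n) - suminf a = (1 - x) * (\<Sum>n. R n * x ^ n)\<close>. The factor \<open>1 - x\<close> kills any
  finite initial segment, and compensates the geometric sum of a uniformly small tail.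
\<close>

lemma Abel_limit_left:
  fixes a :: "nat \<Rightarrow> real"
  assumes "summable a"
  shows "((\<lambda>x. \<Sum>n. a n * x ^ n) \<longlongrightarrow> suminf a) (at_left 1)"
proof -
  define R where "R = (\<lambda>n. (\<Sum>k\<le>n. a k) - suminf a)"
  have Rlim: "R \<longlonglongrightarrow> 0"
    unfolding R_def using summable_LIMSEQ'[OF assms] by (simp add: LIM_zero)
  then obtain B where B: "\<And>n. \<bar>R n\<bar> \<le> B"
    using convergent_imp_Bseq[of R] by (auto simp: convergent_def Bseq_def)
  have rep: "(\<Sum>n. a n * x ^ n) - suminf a = (1 - x) * (\<Sum>n. R n * x ^ n)"
    and R_abs: "summable (\<lambda>n. \<bar>R n\<bar> * x ^ n)" if x: "0 < x" "x < 1" for x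
  proof -
    have geo: "summable (\<lambda>n. B * x ^ n)" using x by (intro summable_mult summable_geometric) auto
    show R_abs: "summable (\<lambda>n. \<bar>R n\<bar> * x ^ n)"
      using x B by (intro summable_comparison_test'[OF geo, of 0]) (auto intro!: mult_right_mono)
    have R: "summable (\<lambda>n. R n * x ^ n)"
      using x by (intro summable_rabs_cancel[of "\<lambda>n. R n * x ^ n"]) (use R_abs in \<open>simp add: abs_mult\<close>)
    have "(\<lambda>n. R (Suc n) * x ^ Suc n - x * (R n * x ^ n)) sums
        ((suminf (\<lambda>n. R n * x ^ n) - R 0) - x * (\<Sum>n. R n * x ^ n))"
      using summable_sums[OF R] sums_Suc_iff[of "\<lambda>n. R n * x ^ n" "(\<Sum>n. R n * x ^ n) - R 0"]
      by (intro sums_diff sums_mult) auto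
    also have "(\<lambda>n. R (Suc n) * x ^ Suc n - x * (R n * x ^ n)) = (\<lambda>n. a (Suc n) * x ^ Suc n)"
      by (auto simp: R_def algebra_simps)
    finally have "(\<lambda>n. a n * x ^ n) sums
        ((suminf (\<lambda>n. R n * x ^ n) - R 0) - x * (\<Sum>n. R n * x ^ n) + a 0 * x ^ 0)"
      by (rule sums_Suc)
    then show "(\<Sum>n. a n * x ^ n) - suminf a = (1 - x) * (\<Sum>n. R n * x ^ n)"
      by (simp add: sums_iff R_def algebra_simps)
  qed
  have "((\<lambda>x. (\<Sum>n. a n * x ^ n) - suminf a) \<longlongrightarrow> 0) (at_left 1)"
  proof (rule tendstoI)
    fix e :: real assume e: "e > 0"
    obtain m where m: "\<And>n. n \<ge> m \<Longrightarrow> \<bar>R n\<bar> < e / 2"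
      using LIMSEQ_D[OF Rlim, of "e / 2"] e by auto
    have "((\<lambda>x. (1 - x) * (\<Sum>n<m. \<bar>R n\<bar>)) \<longlongrightarrow> (1 - 1) * (\<Sum>n<m. \<bar>R n\<bar>)) (at_left 1)"
      by (intro tendsto_intros)
    then have "eventually (\<lambda>x. (1 - x) * (\<Sum>n<m. \<bar>R n\<bar>) < e / 2) (at_left 1)"
      using e by (intro order_tendstoD(2)[of _ 0]) auto
    moreover have "eventually (\<lambda>x::real. x > 0) (at_left 1)"
      by (intro eventually_at_leftI[of 0]) auto
    moreover have "eventually (\<lambda>x::real. x < 1) (at_left 1)"
      by (simp add: eventually_at_filter)
    ultimately show "eventually (\<lambda>x. dist ((\<Sum>n. a n * x ^ n) - suminf a) 0 < e) (at_left 1)"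
    proof eventually_elim
      case (elim x)
      note R_abs = R_abs[OF elim(2,3)]
      have "\<bar>\<Sum>n. R n * x ^ n\<bar> \<le> (\<Sum>n. \<bar>R n\<bar> * x ^ n)"
        using summable_rabs[of "\<lambda>n. R n * x ^ n"] R_abs elim by (simp add: abs_mult)
      also have "\<dots> = (\<Sum>n. \<bar>R (n + m)\<bar> * x ^ (n + m)) + (\<Sum>n<m. \<bar>R n\<bar> * x ^ n)"
        by (rule suminf_split_initial_segment[OF R_abs])
      also have "(\<Sum>n. \<bar>R (n + m)\<bar> * x ^ (n + m)) \<le> (\<Sum>n. e / 2 * x ^ n)"
      proof (rule suminf_le)
        fix n
        have "x ^ (n + m) \<le> x ^ n" using elim by (intro power_decreasing) auto
        then show "\<bar>R (n + m)\<bar> * x ^ (n + m) \<le> e / 2 * x ^ n"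
          using m[of "n + m"] elim by (intro mult_mono) auto
      qed (use R_abs elim summable_iff_shift[of "\<lambda>n. \<bar>R n\<bar> * x ^ n" m] in
            \<open>auto intro!: summable_mult summable_geometric\<close>)
      also have "(\<Sum>n. e / 2 * x ^ n) = e / 2 / (1 - x)"
        using sums_mult[OF geometric_sums[of x], of "e / 2"] elim by (simp add: sums_iff)
      also have "(\<Sum>n<m. \<bar>R n\<bar> * x ^ n) \<le> (\<Sum>n<m. \<bar>R n\<bar>)"
        using elim by (intro sum_mono mult_left_le) (auto simp: power_le_one)
      finally have "(1 - x) * \<bar>\<Sum>n. R n * x ^ n\<bar> \<le> (1 - x) * (e / 2 / (1 - x) + (\<Sum>n<m. \<bar>R n\<bar>))"
        using elim by (intro mult_left_mono) auto
      also have "\<dots> = e / 2 + (1 - x) * (\<Sum>n<m. \<bar>R n\<bar>)"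
        using elim by (simp add: field_simps)
      also have "\<dots> < e" using elim by simp
      finally show ?case using elim by (simp add: rep abs_mult)
    qed
  qed
  then show ?thesis by (simp add: LIM_zero_iff)
qed

context prob_space
begin

text \<open>
  The summability hypothesis says that \<open>cosh (Z \<omega>)\<close>, which majorizes the partial sums of the series of
  \<open>cos (Z \<omega>)\<close>, is integrable. Term-by-term integration is therefore legitimate.
\<close>

lemma expectation_cos_even_moments_abs:
  fixes Z :: "'a \<Rightarrow> real"
  assumes [measurable]: "random_variable borel Z"
    and m: "\<And>j. (\<integral>\<^sup>+\<omega>. ennreal (Z \<omega> ^ (2 * j)) \<partial>M) = ennreal (m j)" "\<And>j. m j \<ge> 0"
    and sm: "summable (\<lambda>j. m j / fact (2 * j))"
  shows "(\<lambda>j. (-1) ^ j * m j / fact (2 * j)) sums expectation (\<lambda>\<omega>. cos (Z \<omega>))"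
proof -
  define f where "f = (\<lambda>j \<omega>. (-1) ^ j / fact (2 * j) * Z \<omega> ^ (2 * j))"
  have moment: "has_bochner_integral M (\<lambda>\<omega>. Z \<omega> ^ (2 * j)) (m j)" for j
    using m by (intro has_bochner_integral_nn_integral) auto
  have f: "has_bochner_integral M (f j) ((-1) ^ j / fact (2 * j) * m j)" for j
    unfolding f_def by (intro has_bochner_integral_mult_right moment)
  have nf: "has_bochner_integral M (\<lambda>\<omega>. norm (f j \<omega>)) (1 / fact (2 * j) * m j)" for j
    using has_bochner_integral_mult_right[OF moment, of "1 / fact (2 * j)" j]
    by (simp add: f_def abs_mult power_abs power_mult)
  have "(\<lambda>j. integral\<^sup>L M (f j)) sums (\<integral>\<omega>. (\<Sum>j. f j \<omega>) \<partial>M)"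
  proof (rule sums_integral)
    show "integrable M (f j)" for j using f by (auto simp: has_bochner_integral_iff)
    show "AE \<omega> in M. summable (\<lambda>j. norm (f j \<omega>))"
    proof (intro AE_I2)
      fix \<omega>
      show "summable (\<lambda>j. norm (f j \<omega>))"
        using sums_summable[OF cosh_paired[of "Z \<omega>"]] by (simp add: f_def abs_mult power_abs power_mult)
    qed
    show "summable (\<lambda>j. \<integral>\<omega>. norm (f j \<omega>) \<partial>M)"
      using sm has_bochner_integral_integral_eq[OF nf] by simp
  qed
  moreover have "(\<Sum>j. f j \<omega>) = cos (Z \<omega>)" for \<omega>
    using cos_paired[of "Z \<omega>"] by (simp add: f_def sums_iff)
  ultimately show ?thesis
    using has_bochner_integral_integral_eq[OF f] by (simp add: mult.commute)
qed

text \<open>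
  Under mere convergence, the exchange of sum and expectation is valid for \<open>sqrt x * Z\<close> with
  \<open>0 < x < 1\<close>, since a convergent power series converges absolutely inside. Abel's theorem and
  dominated convergence carry the identity to \<open>x = 1\<close>.
\<close>

lemma expectation_cos_even_moments:
  fixes Z :: "'a \<Rightarrow> real"
  assumes [measurable]: "random_variable borel Z"
    and m: "\<And>j. (\<integral>\<^sup>+\<omega>. ennreal (Z \<omega> ^ (2 * j)) \<partial>M) = ennreal (m j)" "\<And>j. m j \<ge> 0"
    and sm: "summable (\<lambda>j. (-1) ^ j * m j / fact (2 * j))"
  shows "expectation (\<lambda>\<omega>. cos (Z \<omega>)) = (\<Sum>j. (-1) ^ j * m j / fact (2 * j))"
proof -
  define a where "a = (\<lambda>j. (-1) ^ j * m j / fact (2 * j))"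
  have inside: "expectation (\<lambda>\<omega>. cos (sqrt x * Z \<omega>)) = (\<Sum>j. a j * x ^ j)" if x: "0 < x" "x < 1" for x
  proof -
    have "summable (\<lambda>j. a j * 1 ^ j)" using sm by (simp add: a_def)
    then have "summable (\<lambda>j. norm (a j * x ^ j))" by (rule powser_insidea) (use x in auto)
    then have "summable (\<lambda>j. x ^ j * m j / fact (2 * j))"
      using x m by (simp add: a_def abs_mult power_abs mult_ac)
    moreover have "(\<integral>\<^sup>+\<omega>. ennreal ((sqrt x * Z \<omega>) ^ (2 * j)) \<partial>M) = ennreal (x ^ j * m j)" for j
    proof -
      have "(\<integral>\<^sup>+\<omega>. ennreal ((sqrt x * Z \<omega>) ^ (2 * j)) \<partial>M)
         = (\<integral>\<^sup>+\<omega>. ennreal (x ^ j) * ennreal (Z \<omega> ^ (2 * j)) \<partial>M)"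
        using x by (intro nn_integral_cong) (simp add: power_mult_distrib power_mult flip: ennreal_mult)
      then show ?thesis using x m by (simp add: nn_integral_cmult ennreal_mult)
    qed
    ultimately have "(\<lambda>j. (-1) ^ j * (x ^ j * m j) / fact (2 * j)) sums expectation (\<lambda>\<omega>. cos (sqrt x * Z \<omega>))"
      using x m by (intro expectation_cos_even_moments_abs) auto
    then show ?thesis by (simp add: sums_iff a_def mult_ac)
  qed
  have "((\<lambda>x. \<Sum>j. a j * x ^ j) \<longlongrightarrow> suminf a) (at_left 1)"
    using sm by (intro Abel_limit_left) (simp add: a_def)
  moreover have "((\<lambda>x. \<Sum>j. a j * x ^ j) \<longlongrightarrow> expectation (\<lambda>\<omega>. cos (Z \<omega>))) (at_left 1)"
  proof -
    have "((\<lambda>x. expectation (\<lambda>\<omega>. cos (sqrt x * Z \<omega>))) \<longlongrightarrow> expectation (\<lambda>\<omega>. cos (Z \<omega>))) (at_left 1)"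
    proof (rule tendsto_at_left_sequentially[of 0])
      fix S :: "nat \<Rightarrow> real" assume S: "S \<longlonglongrightarrow> 1"
      show "(\<lambda>n. expectation (\<lambda>\<omega>. cos (sqrt (S n) * Z \<omega>))) \<longlonglongrightarrow> expectation (\<lambda>\<omega>. cos (Z \<omega>))"
      proof (rule integral_dominated_convergence[where w = "\<lambda>_. 1"])
        show "AE \<omega> in M. (\<lambda>n. cos (sqrt (S n) * Z \<omega>)) \<longlonglongrightarrow> cos (Z \<omega>)"
        proof (intro AE_I2)
          fix \<omega>
          have "(\<lambda>n. cos (sqrt (S n) * Z \<omega>)) \<longlonglongrightarrow> cos (sqrt 1 * Z \<omega>)"
            by (intro tendsto_intros S)
          then show "(\<lambda>n. cos (sqrt (S n) * Z \<omega>)) \<longlonglongrightarrow> cos (Z \<omega>)" by simp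
        qed
      qed auto
    qed auto
    moreover have "eventually (\<lambda>x. expectation (\<lambda>\<omega>. cos (sqrt x * Z \<omega>)) = (\<Sum>j. a j * x ^ j)) (at_left 1)"
      using inside by (intro eventually_at_leftI[of 0]) auto
    ultimately show ?thesis by (rule Lim_transform_eventually)
  qed
  ultimately show ?thesis
    unfolding a_def by (intro tendsto_unique) (auto simp: trivial_limit_at_left_real)
qed

end

lemma (in prob_space) summable_even_moments:
  fixes Z :: "'a \<Rightarrow> real"
  assumes [measurable]: "random_variable borel Z"
    and m: "\<And>j. (\<integral>\<^sup>+\<omega>. ennreal (Z \<omega> ^ (2 * j)) \<partial>M) = ennreal (m j)" "\<And>j. m j \<ge> 0"
    and fin: "(\<integral>\<^sup>+\<omega>. ennreal (cosh (Z \<omega>)) \<partial>M) < \<infinity>"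
  shows "summable (\<lambda>j. m j / fact (2 * j))"
proof -
  have "(\<integral>\<^sup>+\<omega>. ennreal (cosh (Z \<omega>)) \<partial>M)
      = (\<integral>\<^sup>+\<omega>. (\<Sum>j. ennreal (1 / fact (2 * j)) * ennreal (Z \<omega> ^ (2 * j))) \<partial>M)"
  proof (intro nn_integral_cong)
    fix \<omega>
    have "(\<lambda>j. ennreal (Z \<omega> ^ (2 * j) / fact (2 * j))) sums ennreal (cosh (Z \<omega>))"
      using cosh_paired[of "Z \<omega>"] by (subst sums_ennreal) (auto simp: power_mult)
    then show "ennreal (cosh (Z \<omega>)) = (\<Sum>j. ennreal (1 / fact (2 * j)) * ennreal (Z \<omega> ^ (2 * j)))"
      by (simp add: sums_iff flip: ennreal_mult)
  qed
  also have "\<dots> = (\<Sum>j. ennreal (1 / fact (2 * j)) * ennreal (m j))"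
    by (subst nn_integral_suminf) (auto simp: nn_integral_cmult m(1))
  also have "\<dots> = (\<Sum>j. ennreal (m j / fact (2 * j)))"
    using m(2) by (simp flip: ennreal_mult)
  finally show ?thesis
    using fin m(2) by (intro summable_suminf_not_top) auto
qed

section \<open>Radial integrals of the generator\<close>

definition hurwitz_lerch_integral :: "real \<Rightarrow> real \<Rightarrow> real \<Rightarrow> real" where
  "hurwitz_lerch_integral v \<sigma> \<alpha> =
     (LINT x:{0<..}|lborel. x powr (\<sigma> - 1) * (exp (- \<alpha> * x) / (1 + exp (- x)) powr v))"

text \<open>
  At \<open>z = -1\<close> the base \<open>1 + exp (- t)\<close> is a positive real, so the complex power and integral are real.
\<close>

lemma hurwitz_lerch_star_minus_one:
  "hurwitz_lerch_star v (-1) \<sigma> \<alpha> = of_real (hurwitz_lerch_integral v \<sigma> \<alpha> / Gamma \<sigma>)"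
proof -
  have "complex_of_real (x powr (\<sigma> - 1) * exp (- \<alpha> * x)) /
        (1 - (-1) * complex_of_real (exp (- x))) powr complex_of_real v
      = complex_of_real (x powr (\<sigma> - 1) * (exp (- \<alpha> * x) / (1 + exp (- x)) powr v))" for x
  proof -
    have "1 - (-1) * complex_of_real (exp (- x)) = complex_of_real (1 + exp (- x))" by simp
    also have "\<dots> powr complex_of_real v = complex_of_real ((1 + exp (- x)) powr v)"
      by (rule powr_of_real) (simp add: add_nonneg_nonneg)
    finally show ?thesis by simp
  qed
  then show ?thesis
    unfolding hurwitz_lerch_star_def hurwitz_lerch_integral_def
    by (simp only: set_integral_complex_of_real) simp
qed

lemma exp_div_powr_le: "v \<ge> 0 \<Longrightarrow> exp x / (1 + exp y) powr v \<le> exp (x::real)"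
  using ge_one_powr_ge_zero[of "1 + exp y" v] by (simp add: divide_le_eq)

lemma nn_integral_hurwitz_lerch:
  assumes "\<sigma> > 0" "\<alpha> > 0" "v \<ge> 0"
  shows "(\<integral>\<^sup>+x. ennreal (x powr (\<sigma> - 1)) * indicator {0<..} x *
            ennreal (exp (- \<alpha> * x) / (1 + exp (- x)) powr v) \<partial>lborel)
     = ennreal (hurwitz_lerch_integral v \<sigma> \<alpha>)" (is "?I = _")
    and "hurwitz_lerch_integral v \<sigma> \<alpha> \<ge> 0"
proof -
  define f where "f = (\<lambda>x. indicator {0<..} x * (x powr (\<sigma> - 1) * (exp (- \<alpha> * x) / (1 + exp (- x)) powr v)))"
  have [measurable]: "f \<in> borel_measurable borel" unfolding f_def by measurable
  have fI: "?I = (\<integral>\<^sup>+x. ennreal (f x) \<partial>lborel)"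
    by (intro nn_integral_cong) (auto simp: f_def indicator_def simp flip: ennreal_mult)
  have "?I \<le> (\<integral>\<^sup>+\<rho>. ennreal (\<rho> powr (\<sigma> * 1 - 1)) * indicator {0<..} \<rho> * ennreal (exp (- (\<alpha> * \<rho> powr 1))) \<partial>lborel)"
    using exp_div_powr_le[of v] assms
    by (intro nn_integral_mono) (auto simp: indicator_def intro!: mult_left_mono ennreal_leI)
  also have "\<dots> < \<infinity>"
    using assms by (subst nn_integral_stretched_Gamma) auto
  finally have "integrable lborel f"
    unfolding fI by (intro integrableI_nonneg) (auto simp: f_def)
  then have "(\<integral>\<^sup>+x. ennreal (f x) \<partial>lborel) = ennreal (\<integral>x. f x \<partial>lborel)"
    by (intro nn_integral_eq_integral) (auto simp: f_def)
  also have "(\<integral>x. f x \<partial>lborel) = hurwitz_lerch_integral v \<sigma> \<alpha>"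
    by (simp add: f_def hurwitz_lerch_integral_def set_lebesgue_integral_def)
  finally show "?I = ennreal (hurwitz_lerch_integral v \<sigma> \<alpha>)" using fI by simp
  show "hurwitz_lerch_integral v \<sigma> \<alpha> \<ge> 0"
    unfolding hurwitz_lerch_integral_def set_lebesgue_integral_def
    by (intro integral_nonneg_AE AE_I2) simp
qed

lemma gl_generator_nonneg: "gl_generator N a b s r \<rho> \<ge> 0"
  by (simp add: gl_generator_def)

lemma gl_generator_measurable [measurable]: "gl_generator N a b s r \<in> borel_measurable borel"
  unfolding gl_generator_def by measurable

lemma nn_integral_gl_generator:
  fixes N a b s r k :: real
  assumes "a > 0" "b > 0" "s > 0" "r \<ge> 0" "k + N - 1 > 0"
  defines "\<sigma> \<equiv> (k + N - 1) / s"
  shows "(\<integral>\<^sup>+\<rho>. ennreal (\<rho> powr (k - 1)) * indicator {0<..} \<rho> * ennreal (gl_generator N a b s r \<rho>) \<partial>lborel)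
     = ennreal (b powr (- \<sigma>) / s * hurwitz_lerch_integral (2 * r) \<sigma> (a / b))"
proof -
  have \<sigma>: "\<sigma> > 0" "\<sigma> * s = k + N - 1" using assms by (auto simp: \<sigma>_def)
  define h where "h = (\<lambda>x. ennreal (exp (- (a / b) * x) / (1 + exp (- x)) powr (2 * r)))"
  have "(\<integral>\<^sup>+\<rho>. ennreal (\<rho> powr (k - 1)) * indicator {0<..} \<rho> * ennreal (gl_generator N a b s r \<rho>) \<partial>lborel)
     = (\<integral>\<^sup>+\<rho>. ennreal (\<rho> powr (\<sigma> * s - 1)) * indicator {0<..} \<rho> * h (b * \<rho> powr s) \<partial>lborel)"
  proof (intro nn_integral_cong)
    fix \<rho> :: real
    have "\<rho> powr (k - 1) * gl_generator N a b s r \<rho>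
        = \<rho> powr (\<sigma> * s - 1) * (exp (- (a / b) * (b * \<rho> powr s)) / (1 + exp (- (b * \<rho> powr s))) powr (2 * r))"
      if "\<rho> > 0"
      using that assms(2) powr_add[of \<rho> "k - 1" "N - 1"]
      by (simp add: gl_generator_def \<sigma>(2) algebra_simps)
    then show "ennreal (\<rho> powr (k - 1)) * indicator {0<..} \<rho> * ennreal (gl_generator N a b s r \<rho>)
      = ennreal (\<rho> powr (\<sigma> * s - 1)) * indicator {0<..} \<rho> * h (b * \<rho> powr s)"
      unfolding h_def by (auto simp: indicator_def gl_generator_nonneg simp flip: ennreal_mult)
  qed
  also have "\<dots> = ennreal (b powr (- \<sigma>) / s) *
      (\<integral>\<^sup>+x. ennreal (x powr (\<sigma> - 1)) * indicator {0<..} x * h x \<partial>lborel)"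
    using assms \<sigma> by (intro nn_integral_powr_substitution) (auto simp: h_def)
  also have "(\<integral>\<^sup>+x. ennreal (x powr (\<sigma> - 1)) * indicator {0<..} x * h x \<partial>lborel)
      = ennreal (hurwitz_lerch_integral (2 * r) \<sigma> (a / b))"
    unfolding h_def using assms \<sigma> by (intro nn_integral_hurwitz_lerch) auto
  finally show ?thesis
    using assms \<sigma> nn_integral_hurwitz_lerch(2)[of \<sigma> "a / b" "2 * r"] by (simp flip: ennreal_mult)
qed

text \<open>
  The hypothesis makes \<open>a * \<rho> powr s\<close> dominate \<open>sqrt (u * \<rho>)\<close> at infinity with room to spare, so
  that a decaying exponent survives. For \<open>s = 1 / 2\<close> its coefficient is \<open>a - sqrt u\<close>; for
  \<open>s > 1 / 2\<close> one half of \<open>a\<close> beats the square root beyond some \<open>R\<close>, and \<open>K\<close> covers the part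
  below \<open>R\<close>.
\<close>

lemma sqrt_minus_powr_bound:
  fixes a s u :: real
  assumes "a > 0" "s > 0" "u \<ge> 0" "s > 1 / 2 \<or> (s = 1 / 2 \<and> u < a\<^sup>2)"
  obtains a' K where "a' > 0"
    "\<And>\<rho>. \<rho> > 0 \<Longrightarrow> sqrt u * sqrt \<rho> - a * \<rho> powr s \<le> K - a' * \<rho> powr s"
proof (cases "s = 1 / 2")
  case True
  then have "sqrt u < a" using assms by (auto intro: real_less_lsqrt)
  moreover have "\<rho> powr s = sqrt \<rho>" if "\<rho> > 0" for \<rho>
    using that by (simp add: True powr_half_sqrt)
  ultimately show ?thesis
    by (intro that[of "a - sqrt u" 0]) (auto simp: algebra_simps)
next
  case False
  with assms have s: "s > 1 / 2" by auto
  \<comment> \<open>Beyond \<open>R\<close> the inequality \<open>sqrt u * sqrt \<rho> \<le> a / 2 * \<rho> powr s\<close> holds.\<close>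
  define R where "R = (2 * sqrt u / a) powr (1 / (s - 1 / 2))"
  have Rs: "R powr (s - 1 / 2) = 2 * sqrt u / a"
    using s assms by (cases "u = 0") (auto simp: R_def powr_powr)
  show ?thesis
  proof (rule that[of "a / 2" "sqrt u * sqrt R"])
    fix \<rho> :: real assume \<rho>: "\<rho> > 0"
    show "sqrt u * sqrt \<rho> - a * \<rho> powr s \<le> sqrt u * sqrt R - a / 2 * \<rho> powr s"
    proof (cases "\<rho> \<le> R")
      case True
      then have "sqrt u * sqrt \<rho> \<le> sqrt u * sqrt R" using assms by (intro mult_left_mono) auto
      moreover have "a / 2 * \<rho> powr s \<ge> 0" using assms by simp
      ultimately show ?thesis by simp
    next
      case False
      then have "R powr (s - 1 / 2) \<le> \<rho> powr (s - 1 / 2)"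
        using s by (intro powr_mono2) (auto simp: R_def)
      then have "sqrt u * sqrt \<rho> \<le> a / 2 * \<rho> powr (s - 1 / 2) * sqrt \<rho>"
        using assms \<rho> unfolding Rs by (intro mult_right_mono) (auto simp: field_simps)
      also have "\<dots> = a / 2 * \<rho> powr s"
        using \<rho> powr_add[of \<rho> "s - 1 / 2" "1 / 2"] by (simp add: powr_half_sqrt)
      finally have "sqrt u * sqrt \<rho> \<le> a / 2 * \<rho> powr s" .
      moreover have "sqrt u * sqrt R \<ge> 0" using assms by (simp add: R_def)
      ultimately show ?thesis by (simp add: field_simps)
    qed
  qed (use assms in auto)
qed

lemma nn_integral_gl_generator_exp_sqrt_finite:
  fixes N a b s r k u :: real
  assumes "a > 0" "b > 0" "s > 0" "r \<ge> 0" "k + N - 1 > 0" "u \<ge> 0"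
    and cond: "s > 1 / 2 \<or> (s = 1 / 2 \<and> u < a\<^sup>2)"
  shows "(\<integral>\<^sup>+\<rho>. ennreal (\<rho> powr (k - 1)) * indicator {0<..} \<rho> *
      ennreal (exp (sqrt u * sqrt \<rho>) * gl_generator N a b s r \<rho>) \<partial>lborel) < \<infinity>"
proof -
  obtain a' K where a': "a' > 0"
    "\<And>\<rho>. \<rho> > 0 \<Longrightarrow> sqrt u * sqrt \<rho> - a * \<rho> powr s \<le> K - a' * \<rho> powr s"
    using sqrt_minus_powr_bound[OF assms(1,3,6) cond] by blast
  define \<sigma> where "\<sigma> = (k + N - 1) / s"
  have \<sigma>: "\<sigma> > 0" "\<sigma> * s = k + N - 1" using assms by (auto simp: \<sigma>_def)
  have "(\<integral>\<^sup>+\<rho>. ennreal (\<rho> powr (k - 1)) * indicator {0<..} \<rho> *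
      ennreal (exp (sqrt u * sqrt \<rho>) * gl_generator N a b s r \<rho>) \<partial>lborel)
    \<le> (\<integral>\<^sup>+\<rho>. ennreal (exp K) * (ennreal (\<rho> powr (\<sigma> * s - 1)) * indicator {0<..} \<rho> *
           ennreal (exp (- (a' * \<rho> powr s)))) \<partial>lborel)"
  proof (intro nn_integral_mono)
    fix \<rho> :: real
    have "\<rho> powr (k - 1) * (exp (sqrt u * sqrt \<rho>) * gl_generator N a b s r \<rho>)
        \<le> exp K * (\<rho> powr (\<sigma> * s - 1) * exp (- (a' * \<rho> powr s)))" if \<rho>: "\<rho> > 0"
    proof -
      have "\<rho> powr (k - 1) * (exp (sqrt u * sqrt \<rho>) * gl_generator N a b s r \<rho>)
        = \<rho> powr (\<sigma> * s - 1) * (exp (sqrt u * sqrt \<rho>) *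
           (exp (- a * \<rho> powr s) / (1 + exp (- b * \<rho> powr s)) powr (2 * r)))"
        using \<rho> powr_add[of \<rho> "k - 1" "N - 1"] by (simp add: gl_generator_def \<sigma>(2) algebra_simps)
      also have "\<dots> \<le> \<rho> powr (\<sigma> * s - 1) * (exp (sqrt u * sqrt \<rho>) * exp (- a * \<rho> powr s))"
        using assms by (intro mult_left_mono exp_div_powr_le) auto
      also have "\<dots> = \<rho> powr (\<sigma> * s - 1) * exp (sqrt u * sqrt \<rho> - a * \<rho> powr s)"
        by (simp add: exp_diff exp_minus field_simps)
      also have "\<dots> \<le> \<rho> powr (\<sigma> * s - 1) * exp (K - a' * \<rho> powr s)"
        using a'(2)[OF \<rho>] by (intro mult_left_mono) auto
      finally show ?thesis by (simp add: exp_diff exp_minus field_simps)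
    qed
    then show "ennreal (\<rho> powr (k - 1)) * indicator {0<..} \<rho> *
        ennreal (exp (sqrt u * sqrt \<rho>) * gl_generator N a b s r \<rho>)
      \<le> ennreal (exp K) * (ennreal (\<rho> powr (\<sigma> * s - 1)) * indicator {0<..} \<rho> *
           ennreal (exp (- (a' * \<rho> powr s))))"
      by (auto simp: indicator_def gl_generator_nonneg simp flip: ennreal_mult intro!: ennreal_leI)
  qed
  also have "\<dots> = ennreal (exp K) * ennreal (a' powr (- \<sigma>) / s * Gamma \<sigma>)"
    unfolding nn_integral_stretched_Gamma[OF a'(1) \<open>s > 0\<close> \<sigma>(1), symmetric]
    by (intro nn_integral_cmult) measurable
  also have "\<dots> < \<infinity>" by (simp add: ennreal_mult_less_top)
  finally show ?thesis .
qed

section \<open>Moments and symmetry of an elliptical random vector\<close>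

lemma nn_integral_lborel_uminus:
  fixes \<phi> :: "'a::euclidean_space \<Rightarrow> ennreal"
  assumes [measurable]: "\<phi> \<in> borel_measurable borel"
  shows "(\<integral>\<^sup>+y. \<phi> (- y) \<partial>lborel) = (\<integral>\<^sup>+y. \<phi> y \<partial>lborel)"
proof -
  have "(\<integral>\<^sup>+y. \<phi> y \<partial>lborel)
      = (\<integral>\<^sup>+y. \<phi> y \<partial>density (distr lborel borel (\<lambda>x. 0 + (-1) *\<^sub>R x)) (\<lambda>_. ennreal (\<bar>-1\<bar> ^ DIM('a))))"
    by (subst lborel_affine[of "-1" "0::'a"]) auto
  then show ?thesis by (simp add: nn_integral_density nn_integral_distr)
qed

text \<open>
  The constant in front of \<open>g (mahalanobis_sq \<Sigma> y)\<close> in the density of \<open>X - \<mu>\<close>.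
\<close>

definition gl_factor :: "real ^ 'n \<Rightarrow> real ^ 'n ^ 'n \<Rightarrow> (real \<Rightarrow> real) \<Rightarrow> real" where
  "gl_factor \<mu> \<Sigma> g = gl_const \<mu> \<Sigma> g * det \<Sigma> powr (- 1 / 2)"

context
  fixes M :: "'a measure" and X :: "'a \<Rightarrow> real ^ 'n" and \<mu> :: "real ^ 'n"
    and \<Sigma> :: "real ^ 'n ^ 'n" and g :: "real \<Rightarrow> real"
  assumes GL: "GL_distributed M X \<mu> \<Sigma> g"
    and g_meas [measurable]: "g \<in> borel_measurable borel"
    and g_nonneg: "\<And>x. g x \<ge> 0"
begin

interpretation prob_space M
  using GL by (simp add: GL_distributed_def)

lemma GL_distributed_measurable: "X \<in> borel_measurable M"
  using GL by (auto simp: GL_distributed_def distributed_def)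

lemma gl_factor_nonneg: "gl_factor \<mu> \<Sigma> g \<ge> 0"
proof -
  have "(LINT x|lborel. gl_kernel \<mu> \<Sigma> g x) \<ge> 0"
    by (intro integral_nonneg_AE AE_I2) (simp add: gl_kernel_def g_nonneg)
  then show ?thesis by (simp add: gl_factor_def gl_const_def)
qed

lemma nn_integral_GL_distributed:
  assumes [measurable]: "\<phi> \<in> borel_measurable borel"
  shows "(\<integral>\<^sup>+\<omega>. \<phi> (X \<omega> - \<mu>) \<partial>M)
     = ennreal (gl_factor \<mu> \<Sigma> g) * (\<integral>\<^sup>+y. \<phi> y * ennreal (g (mahalanobis_sq \<Sigma> y)) \<partial>lborel)"
proof -
  let ?f = "\<lambda>x. ennreal (gl_const \<mu> \<Sigma> g * gl_kernel \<mu> \<Sigma> g x)"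
  have f: "?f x = ennreal (gl_factor \<mu> \<Sigma> g) * ennreal (g (mahalanobis_sq \<Sigma> (x - \<mu>)))" for x
    using gl_factor_nonneg g_nonneg
    by (simp add: gl_factor_def gl_kernel_def mahalanobis_sq_def mult.assoc flip: ennreal_mult)
  have "distributed M lborel X ?f" using GL by (simp add: GL_distributed_def)
  then have "(\<integral>\<^sup>+\<omega>. \<phi> (X \<omega> - \<mu>) \<partial>M) = (\<integral>\<^sup>+x. ?f x * \<phi> (x - \<mu>) \<partial>lborel)"
    by (intro distributed_nn_integral[symmetric]) auto
  also have "\<dots> = (\<integral>\<^sup>+x. ennreal (gl_factor \<mu> \<Sigma> g) *
      ennreal (g (mahalanobis_sq \<Sigma> (x - \<mu>))) * \<phi> (x - \<mu>) \<partial>distr lborel borel ((+) \<mu>))"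
    unfolding f by (simp add: lborel_distr_plus)
  also have "\<dots> = (\<integral>\<^sup>+y. ennreal (gl_factor \<mu> \<Sigma> g) * (\<phi> y * ennreal (g (mahalanobis_sq \<Sigma> y))) \<partial>lborel)"
    by (subst nn_integral_distr) (auto simp: ac_simps)
  also have "\<dots> = ennreal (gl_factor \<mu> \<Sigma> g) * (\<integral>\<^sup>+y. \<phi> y * ennreal (g (mahalanobis_sq \<Sigma> y)) \<partial>lborel)"
    by (intro nn_integral_cmult) auto
  finally show ?thesis .
qed

text \<open>
  The density of \<open>X - \<mu>\<close> is even, so the sine part of the expectation vanishes. Adding \<open>1\<close> to the
  sine makes the integrands nonnegative, which allows the comparison of \<open>sin\<close> and \<open>- sin\<close> with
  nonnegative integrals.
\<close>

lemma char_fun_GL_distributed: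
  "char_fun M X t = exp (\<i> * of_real (t \<bullet> \<mu>)) * of_real (expectation (\<lambda>\<omega>. cos (t \<bullet> (X \<omega> - \<mu>))))"
proof -
  note [measurable] = GL_distributed_measurable
  define Z where "Z = (\<lambda>\<omega>. t \<bullet> (X \<omega> - \<mu>))"
  have [measurable]: "Z \<in> borel_measurable M" unfolding Z_def by measurable
  have int: "integrable M (\<lambda>\<omega>. sin (Z \<omega>))" "integrable M (\<lambda>\<omega>. cos (Z \<omega>))"
    by (rule integrable_const_bound[where B = 1]; simp)+
  have "(\<integral>\<^sup>+\<omega>. ennreal (1 + sin (Z \<omega>)) \<partial>M)
     = ennreal (gl_factor \<mu> \<Sigma> g) *
       (\<integral>\<^sup>+y. ennreal (1 + sin (t \<bullet> y)) * ennreal (g (mahalanobis_sq \<Sigma> y)) \<partial>lborel)"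
    unfolding Z_def by (rule nn_integral_GL_distributed) measurable
  also have "(\<integral>\<^sup>+y. ennreal (1 + sin (t \<bullet> y)) * ennreal (g (mahalanobis_sq \<Sigma> y)) \<partial>lborel)
     = (\<integral>\<^sup>+y. ennreal (1 + sin (t \<bullet> (- y))) * ennreal (g (mahalanobis_sq \<Sigma> (- y))) \<partial>lborel)"
    by (rule nn_integral_lborel_uminus[symmetric]) measurable
  also have "\<dots> = (\<integral>\<^sup>+y. ennreal (1 - sin (t \<bullet> y)) * ennreal (g (mahalanobis_sq \<Sigma> y)) \<partial>lborel)"
    using mahalanobis_sq_scaleR[of \<Sigma> "-1"] by simp
  also have "ennreal (gl_factor \<mu> \<Sigma> g) * \<dots> = (\<integral>\<^sup>+\<omega>. ennreal (1 - sin (Z \<omega>)) \<partial>M)"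
    unfolding Z_def by (rule nn_integral_GL_distributed[symmetric]) measurable
  finally have "(\<integral>\<^sup>+\<omega>. ennreal (1 + sin (Z \<omega>)) \<partial>M) = (\<integral>\<^sup>+\<omega>. ennreal (1 - sin (Z \<omega>)) \<partial>M)" .
  moreover have "0 \<le> 1 + sin (Z \<omega>)" "0 \<le> 1 - sin (Z \<omega>)" for \<omega>
    using sin_ge_minus_one[of "Z \<omega>"] sin_le_one[of "Z \<omega>"] by linarith+
  then have "expectation (\<lambda>\<omega>. 1 + sin (Z \<omega>)) = enn2real (\<integral>\<^sup>+\<omega>. ennreal (1 + sin (Z \<omega>)) \<partial>M)"
      "expectation (\<lambda>\<omega>. 1 - sin (Z \<omega>)) = enn2real (\<integral>\<^sup>+\<omega>. ennreal (1 - sin (Z \<omega>)) \<partial>M)"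
    by (intro integral_eq_nn_integral; simp)+
  ultimately have "expectation (\<lambda>\<omega>. 1 + sin (Z \<omega>)) = expectation (\<lambda>\<omega>. 1 - sin (Z \<omega>))"
    by (simp only:)
  then have sin0: "expectation (\<lambda>\<omega>. sin (Z \<omega>)) = 0"
    using int by (simp add: prob_space)
  have "char_fun M X t = (CLINT \<omega>|M. exp (\<i> * of_real (t \<bullet> \<mu>)) * exp (\<i> * of_real (Z \<omega>)))"
    unfolding char_fun_def Z_def
    by (intro Bochner_Integration.integral_cong) (auto simp: inner_diff_right algebra_simps simp flip: exp_add)
  also have "\<dots> = exp (\<i> * of_real (t \<bullet> \<mu>)) * (CLINT \<omega>|M. exp (\<i> * of_real (Z \<omega>)))" by simp
  also have "(CLINT \<omega>|M. exp (\<i> * of_real (Z \<omega>)))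
      = (CLINT \<omega>|M. complex_of_real (cos (Z \<omega>)) + \<i> * complex_of_real (sin (Z \<omega>)))"
    by (simp add: exp_Euler cos_of_real sin_of_real)
  also have "\<dots> = of_real (expectation (\<lambda>\<omega>. cos (Z \<omega>))) + \<i> * of_real (expectation (\<lambda>\<omega>. sin (Z \<omega>)))"
    using int by (subst Bochner_Integration.integral_add) auto
  finally show ?thesis unfolding sin0 by (simp add: Z_def)
qed

text \<open>
  The Gaussian integral and the normalizing constant occur in the moment of order \<open>2 j\<close> and in the
  total mass \<open>1\<close> (the case \<open>j = 0\<close>) as the same factor, so they cancel in the quotient.
\<close>

lemma GL_distributed_even_moment:
  fixes i :: "nat \<Rightarrow> real" and t :: "real ^ 'n"
  assumes pd: "pos_def_matrix \<Sigma>"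
    and i: "\<And>j. (\<integral>\<^sup>+\<rho>. ennreal (\<rho> powr (real CARD('n) / 2 + real j - 1)) * indicator {0<..} \<rho> *
           ennreal (g \<rho>) \<partial>lborel) = ennreal (i j)" "\<And>j. i j \<ge> 0"
  shows "(\<integral>\<^sup>+\<omega>. ennreal ((t \<bullet> (X \<omega> - \<mu>)) ^ (2 * j)) \<partial>M)
     = ennreal ((t \<bullet> (\<Sigma> *v t)) ^ j * (Gamma (real j + 1 / 2) / sqrt pi) *
         (Gamma (real CARD('n) / 2) / Gamma (real CARD('n) / 2 + real j)) * (i j / i 0))"
    and "i 0 > 0"
proof -
  note [measurable] = GL_distributed_measurable
  define w where "w = gl_factor \<mu> \<Sigma> g"
  define k where "k = (\<lambda>j::nat. real CARD('n) / 2 + real j)"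
  define c where "c = (\<lambda>j. (t \<bullet> (\<Sigma> *v t)) ^ j * (Gamma (real j + 1 / 2) / sqrt pi))"
  have w: "w \<ge> 0" by (simp add: w_def gl_factor_nonneg)
  have k: "k j > 0" for j by (simp add: k_def add_pos_nonneg)
  have u: "t \<bullet> (\<Sigma> *v t) \<ge> 0"
    using pd by (rule pos_def_matrix_inner_nonneg)
  have c: "c j \<ge> 0" for j
    using u Gamma_real_pos[of "real j + 1 / 2"] by (simp add: c_def)
  have c0: "c 0 = 1" by (simp add: c_def Gamma_one_half_real)
  define G where "G = enn2real (\<integral>\<^sup>+y. ennreal (exp (- mahalanobis_sq \<Sigma> y)) \<partial>lborel)"
  have G: "(\<integral>\<^sup>+y. ennreal (exp (- mahalanobis_sq \<Sigma> y)) \<partial>lborel) = ennreal G" "G \<ge> 0"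
    using nn_integral_inner_power_radial(2)[OF pd, of "\<lambda>_. 0" t 0] by (auto simp: G_def)
  have E: "ennreal (Gamma (k j)) * (\<integral>\<^sup>+\<omega>. ennreal ((t \<bullet> (X \<omega> - \<mu>)) ^ (2 * j)) \<partial>M)
      = ennreal (w * c j * G * i j)" for j
  proof -
    have "(\<integral>\<^sup>+\<omega>. ennreal ((t \<bullet> (X \<omega> - \<mu>)) ^ (2 * j)) \<partial>M)
      = ennreal w * (\<integral>\<^sup>+y. ennreal ((t \<bullet> y) ^ (2 * j)) * ennreal (g (mahalanobis_sq \<Sigma> y)) \<partial>lborel)"
      unfolding w_def by (rule nn_integral_GL_distributed) measurable
    then have "ennreal (Gamma (k j)) * (\<integral>\<^sup>+\<omega>. ennreal ((t \<bullet> (X \<omega> - \<mu>)) ^ (2 * j)) \<partial>M)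
      = ennreal w * (ennreal (Gamma (k j)) *
          (\<integral>\<^sup>+y. ennreal ((t \<bullet> y) ^ (2 * j)) * ennreal (g (mahalanobis_sq \<Sigma> y)) \<partial>lborel))"
      by (simp add: ac_simps)
    also have "\<dots> = ennreal w * ((ennreal (c j) * ennreal G) * ennreal (i j))"
      unfolding k_def c_def
      by (subst nn_integral_inner_power_radial(1)[OF pd, of "\<lambda>x. ennreal (g x)"])
         (auto simp: i G nn_integral_inner_power_gaussian[OF pd])
    finally show ?thesis using w c G i by (simp add: ennreal_mult ac_simps)
  qed
  have norm: "Gamma (k 0) = w * G * i 0"
    using E[of 0] w G i Gamma_real_pos[OF k[of 0]] by (simp add: emeasure_space_1 c0)
  then show i0: "i 0 > 0"
    using Gamma_real_pos[OF k[of 0]] i(2)[of 0] by (cases "i 0 = 0") auto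
  have "(\<integral>\<^sup>+\<omega>. ennreal ((t \<bullet> (X \<omega> - \<mu>)) ^ (2 * j)) \<partial>M)
     = ennreal (1 / Gamma (k j)) * (ennreal (Gamma (k j)) *
         (\<integral>\<^sup>+\<omega>. ennreal ((t \<bullet> (X \<omega> - \<mu>)) ^ (2 * j)) \<partial>M))"
    using Gamma_real_pos[OF k[of j]] by (simp flip: ennreal_mult mult.assoc)
  also have "\<dots> = ennreal (1 / Gamma (k j) * (w * c j * G * i j))"
    unfolding E using Gamma_real_pos[OF k[of j]] w c G i by (simp flip: ennreal_mult)
  also have "1 / Gamma (k j) * (w * c j * G * i j) = c j * (w * G * i 0 / Gamma (k j)) * (i j / i 0)"
    using i0 by simp
  finally show "(\<integral>\<^sup>+\<omega>. ennreal ((t \<bullet> (X \<omega> - \<mu>)) ^ (2 * j)) \<partial>M)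
     = ennreal ((t \<bullet> (\<Sigma> *v t)) ^ j * (Gamma (real j + 1 / 2) / sqrt pi) *
         (Gamma (real CARD('n) / 2) / Gamma (real CARD('n) / 2 + real j)) * (i j / i 0))"
    unfolding norm[symmetric] by (simp add: k_def c_def)
qed

text \<open>
  Since \<open>cosh (t \<bullet> y) \<le> exp \<bar>t \<bullet> y\<bar>\<close>, the Cauchy-Schwarz inequality bounds the integrand by a
  function of \<open>mahalanobis_sq \<Sigma> y\<close>, which leaves a radial integral.
\<close>

lemma GL_distributed_exp_moment_finite:
  fixes t :: "real ^ 'n"
  assumes pd: "pos_def_matrix \<Sigma>"
    and fin: "(\<integral>\<^sup>+\<rho>. ennreal (\<rho> powr (real CARD('n) / 2 - 1)) * indicator {0<..} \<rho> *
           ennreal (exp (sqrt (t \<bullet> (\<Sigma> *v t)) * sqrt \<rho>) * g \<rho>) \<partial>lborel) < \<infinity>"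
  shows "(\<integral>\<^sup>+\<omega>. ennreal (cosh (t \<bullet> (X \<omega> - \<mu>))) \<partial>M) < \<infinity>"
proof -
  define u where "u = t \<bullet> (\<Sigma> *v t)"
  define h where "h = (\<lambda>\<rho>. ennreal (exp (sqrt u * sqrt \<rho>) * g \<rho>))"
  define J where "J = (\<integral>\<^sup>+y. h (mahalanobis_sq \<Sigma> y) \<partial>lborel)"
  have [measurable]: "h \<in> borel_measurable borel" unfolding h_def by measurable
  have [measurable]: "(\<lambda>y. cosh (t \<bullet> y)) \<in> borel_measurable borel"
    by (intro borel_measurable_continuous_onI continuous_intros)
  have "(\<integral>\<^sup>+\<omega>. ennreal (cosh (t \<bullet> (X \<omega> - \<mu>))) \<partial>M)
     = ennreal (gl_factor \<mu> \<Sigma> g) *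
       (\<integral>\<^sup>+y. ennreal (cosh (t \<bullet> y)) * ennreal (g (mahalanobis_sq \<Sigma> y)) \<partial>lborel)"
    by (rule nn_integral_GL_distributed) measurable
  also have "\<dots> \<le> ennreal (gl_factor \<mu> \<Sigma> g) * J"
    unfolding J_def h_def
  proof (intro mult_left_mono nn_integral_mono)
    fix y
    have "\<bar>t \<bullet> y\<bar> \<le> sqrt u * sqrt (mahalanobis_sq \<Sigma> y)"
      using inner_square_le_mahalanobis_sq[OF pd, of t y]
      by (metis real_sqrt_abs real_sqrt_le_iff real_sqrt_mult u_def)
    then have "cosh (t \<bullet> y) \<le> exp (sqrt u * sqrt (mahalanobis_sq \<Sigma> y))"
    proof -
      have "exp (t \<bullet> y) + exp (- (t \<bullet> y)) \<le> exp \<bar>t \<bullet> y\<bar> + exp \<bar>t \<bullet> y\<bar>"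
        by (intro add_mono) auto
      then have "cosh (t \<bullet> y) \<le> exp \<bar>t \<bullet> y\<bar>" by (simp add: cosh_def)
      also assume "\<bar>t \<bullet> y\<bar> \<le> sqrt u * sqrt (mahalanobis_sq \<Sigma> y)"
      then have "exp \<bar>t \<bullet> y\<bar> \<le> exp (sqrt u * sqrt (mahalanobis_sq \<Sigma> y))" by simp
      finally show ?thesis .
    qed
    then show "ennreal (cosh (t \<bullet> y)) * ennreal (g (mahalanobis_sq \<Sigma> y))
      \<le> ennreal (exp (sqrt u * sqrt (mahalanobis_sq \<Sigma> y)) * g (mahalanobis_sq \<Sigma> y))"
      using g_nonneg by (auto simp flip: ennreal_mult intro!: ennreal_leI mult_right_mono)
  qed simp
  also have "\<dots> < \<infinity>"
  proof -
    have G: "(\<integral>\<^sup>+y. ennreal (exp (- mahalanobis_sq \<Sigma> y)) \<partial>lborel) < \<infinity>"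
      using nn_integral_inner_power_radial(2)[OF pd, of "\<lambda>_. 0" t 0] by simp
    have "ennreal (Gamma (real CARD('n) / 2)) * J < \<infinity>"
      using nn_integral_inner_power_radial(1)[OF pd, of h 0 t] fin G
      unfolding J_def by (simp add: h_def u_def ennreal_mult_less_top)
    moreover have "Gamma (real CARD('n) / 2) > 0" by (rule Gamma_real_pos) simp
    ultimately have "J < \<infinity>" by (auto simp: ennreal_mult_less_top)
    then show ?thesis by (simp add: ennreal_mult_less_top)
  qed
  finally show ?thesis .
qed

end

section \<open>The characteristic function\<close>

text \<open>
  Here \<open>i j\<close> is the radial integral of the generator against \<open>\<rho> powr (n / 2 + j - 1)\<close>. The Gamma value
  in \<open>gl_q\<close> cancels the one in the definition of the Hurwitz-Lerch function, the power of \<open>b\<close> comes from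
  the substitution, and the Beta value carries the quotient of Gamma values of the moment
  formula. Its remaining factor \<open>Gamma ((n - 1) / 2)\<close> is independent of \<open>j\<close>; it is finite and nonzero
  because \<open>n > 1\<close>.
\<close>

lemma gl_series_term_moment:
  fixes \<Sigma> :: "real ^ 'n ^ 'n" and N a b s r :: real and j :: nat
  assumes n: "CARD('n) > 1" and N: "2 * N + real CARD('n) > 2"
    and pos: "b > 0" "s > 0"
  defines "\<sigma> \<equiv> \<lambda>j::nat. (real CARD('n) / 2 + real j + N - 1) / s"
  defines "i \<equiv> \<lambda>j. b powr (- \<sigma> j) / s * hurwitz_lerch_integral (2 * r) (\<sigma> j) (a / b)"
  shows "gl_series_term N a b s r \<Sigma> t j = of_real ((-1) ^ j *
     ((t \<bullet> (\<Sigma> *v t)) ^ j * (Gamma (real j + 1 / 2) / sqrt pi) *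
         (Gamma (real CARD('n) / 2) / Gamma (real CARD('n) / 2 + real j)) * (i j / i 0)) / fact (2 * j))"
proof -
  let ?n = "real CARD('n)"
  have \<sigma>: "\<sigma> j > 0" for j using N pos by (simp add: \<sigma>_def)
  define q where "q = (\<lambda>j. gl_q N CARD('n) b s (real j))"
  define W where "W = (\<lambda>j. hurwitz_lerch_integral (2 * r) (\<sigma> j) (a / b))"
  define \<Phi> where "\<Phi> = (\<lambda>j. W j / Gamma (\<sigma> j))"
  define B where "B = (\<lambda>j. Gamma (real j + 1 / 2) / Gamma (?n / 2 + real j))"
  have q: "q j = Gamma ((?n - 1) / 2) * b powr (- \<sigma> j) * Gamma (\<sigma> j) * B j" for j
  proof -
    have "1 / s * (?n / 2 + real j + N - 1) = \<sigma> j" by (simp add: \<sigma>_def)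
    moreover have "(2 * real j + 1) / 2 = real j + 1 / 2" by simp
    moreover have "(?n - 1) / 2 + (real j + 1 / 2) = ?n / 2 + real j" by (simp add: field_simps)
    ultimately have "q j = Gamma (\<sigma> j) / b powr \<sigma> j *
        (Gamma ((?n - 1) / 2) * Gamma (real j + 1 / 2) / Gamma (?n / 2 + real j))"
      by (simp only: q_def gl_q_def Beta_def)
    then show ?thesis
      by (simp add: B_def powr_minus_divide)
  qed
  have G: "Gamma ((?n - 1) / 2) > 0" "Gamma (\<sigma> j) > 0" "Gamma (\<sigma> 0) > 0"
    using n \<sigma> by (auto intro!: Gamma_real_pos)
  have "q j * \<Phi> j = (Gamma ((?n - 1) / 2) * s) * (B j * i j)" for j
    using pos Gamma_real_pos[OF \<sigma>[of j]] by (simp add: q \<Phi>_def i_def W_def)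
  moreover have "Gamma ((?n - 1) / 2) * s \<noteq> 0" using G pos by simp
  ultimately have "q j / q 0 * (\<Phi> j / \<Phi> 0) = B j / B 0 * (i j / i 0)"
    by (simp only: times_divide_times_eq) simp
  moreover have "B j / B 0 = Gamma (real j + 1 / 2) / sqrt pi * (Gamma (?n / 2) / Gamma (?n / 2 + real j))"
    by (simp add: B_def Gamma_one_half_real)
  ultimately have ratio: "q j / q 0 * (\<Phi> j / \<Phi> 0) = Gamma (real j + 1 / 2) / sqrt pi *
      (Gamma (?n / 2) / Gamma (?n / 2 + real j)) * (i j / i 0)" by simp
  have "gl_series_term N a b s r \<Sigma> t j
      = of_real ((-1) ^ j / fact (2 * j) * (q j / q 0 * (\<Phi> j / \<Phi> 0)) * (t \<bullet> (\<Sigma> *v t)) ^ j)"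
  proof -
    have "1 / s * (?n / 2 + real j + N - 1) = \<sigma> j" "1 / s * (?n / 2 + N - 1) = \<sigma> 0"
      by (simp_all add: \<sigma>_def)
    then show ?thesis
      by (simp add: gl_series_term_def hurwitz_lerch_star_minus_one q_def \<Phi>_def W_def mult.assoc)
  qed
  then show ?thesis unfolding ratio by (simp add: field_simps)
qed

lemma mahalanobis_sq_scalar_matrix:
  fixes \<sigma> :: real and y :: "real ^ 'n"
  assumes "\<sigma> > 0"
  shows "mahalanobis_sq (mat (\<sigma>\<^sup>2)) y = (norm y)\<^sup>2 / \<sigma>\<^sup>2"
proof -
  have mat: "mat (\<sigma>\<^sup>2) *v x = \<sigma>\<^sup>2 *\<^sub>R x" for x :: "real ^ 'n"
    by (simp add: vec_eq_iff matrix_vector_mult_def mat_def if_distrib if_distribR sum.delta cong: if_cong)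
  have "x = 0" if "mat (\<sigma>\<^sup>2) *v x = 0" for x :: "real ^ 'n"
    using that assms by (simp add: mat)
  then have "invertible (mat (\<sigma>\<^sup>2) :: real ^ 'n ^ 'n)"
    unfolding invertible_left_inverse by (subst matrix_left_invertible_ker) auto
  from matrix_inv_mult_vec(2)[OF this, of y]
  have "\<sigma>\<^sup>2 *\<^sub>R (matrix_inv (mat (\<sigma>\<^sup>2)) *v y) = y" by (simp only: mat)
  then have "(1 / \<sigma>\<^sup>2) *\<^sub>R y = (1 / \<sigma>\<^sup>2) *\<^sub>R (\<sigma>\<^sup>2 *\<^sub>R (matrix_inv (mat (\<sigma>\<^sup>2)) *v y))" by simp
  then have "matrix_inv (mat (\<sigma>\<^sup>2)) *v y = (1 / \<sigma>\<^sup>2) *\<^sub>R y" using assms by simp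
  then show ?thesis by (simp add: mahalanobis_sq_def power2_norm_eq_inner)
qed

text \<open>
  In dimension one \<open>\<bar>vec t \<bullet> y\<bar> = \<bar>t\<bar> * \<sigma> * sqrt (mahalanobis_sq \<Sigma> y)\<close>, so the cosine is radial. The
  sublevel set of the form at \<open>1\<close> is an interval of length \<open>2 * \<sigma>\<close>, which cancels
  the factor \<open>det \<Sigma> powr (- 1 / 2) = 1 / \<sigma>\<close> and the exponent \<open>k = 1 / 2\<close> of the scaling formula, and
  leaves precisely the normalizing constant.
\<close>

lemma GL_distributed_expectation_cos_univariate:
  fixes M :: "'a measure" and X :: "'a \<Rightarrow> real ^ 'n" and \<mu> :: "real ^ 'n" and g :: "real \<Rightarrow> real"
    and \<sigma> t :: real
  defines "\<Sigma> \<equiv> mat (\<sigma>\<^sup>2)"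
  assumes n: "CARD('n) = 1" and \<sigma>: "\<sigma> > 0" and pd: "pos_def_matrix \<Sigma>"
    and GL: "GL_distributed M X \<mu> \<Sigma> g"
    and g_meas [measurable]: "g \<in> borel_measurable borel" and g_nonneg: "\<And>x. g x \<ge> 0"
  shows "(\<integral>\<omega>. cos (vec t \<bullet> (X \<omega> - \<mu>)) \<partial>M)
     = gl_const \<mu> \<Sigma> g * (LINT x:{0<..}|lborel. x powr (- 1 / 2) * g x * cos (t * \<sigma> * sqrt x))"
proof -
  interpret prob_space M using GL by (simp add: GL_distributed_def)
  note [measurable] = GL_distributed_measurable[OF GL g_meas g_nonneg]
  obtain i0 :: 'n where i0: "UNIV = {i0}" using n by (auto simp: card_1_singleton_iff)
  define C where "C = gl_const \<mu> \<Sigma> g"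
  have det: "det \<Sigma> = \<sigma>\<^sup>2"
  proof -
    have "det \<Sigma> = (\<Prod>i\<in>UNIV. \<Sigma> $ i $ i)" by (intro det_diagonal) (auto simp: \<Sigma>_def mat_def)
    then show ?thesis by (simp add: \<Sigma>_def mat_def n)
  qed
  have "(\<sigma>\<^sup>2) powr (- 1 / 2) = (\<sigma> powr 2) powr (- 1 / 2)" using \<sigma> by simp
  also have "\<dots> = 1 / \<sigma>" unfolding powr_powr using \<sigma> by (simp add: powr_minus_divide)
  finally have factor: "gl_factor \<mu> \<Sigma> g = C / \<sigma>"
    by (simp add: gl_factor_def C_def det)
  have C: "C \<ge> 0"
    using gl_factor_nonneg[OF GL g_meas g_nonneg] \<sigma> by (simp add: factor zero_le_divide_iff)
  have Q: "mahalanobis_sq \<Sigma> y = (norm y)\<^sup>2 / \<sigma>\<^sup>2" for y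
    unfolding \<Sigma>_def by (rule mahalanobis_sq_scalar_matrix[OF \<sigma>])
  have ball: "{y. mahalanobis_sq \<Sigma> y \<le> 1} = cball 0 \<sigma>"
    using \<sigma> by (auto simp: Q)
  have V: "(\<integral>\<^sup>+y. 1 * indicator {y. mahalanobis_sq \<Sigma> y \<le> 1} y \<partial>lborel) = ennreal (2 * \<sigma>)"
    unfolding ball using \<sigma> by (simp add: emeasure_cball n unit_ball_vol_1 ennreal_mult)
  have radial: "(\<integral>\<^sup>+\<omega>. h (mahalanobis_sq \<Sigma> (X \<omega> - \<mu>)) \<partial>M)
     = ennreal C * (\<integral>\<^sup>+\<rho>. ennreal (\<rho> powr (- 1 / 2)) * indicator {0<..} \<rho> * (h \<rho> * ennreal (g \<rho>)) \<partial>lborel)"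
    if [measurable]: "h \<in> borel_measurable borel" for h
  proof -
    have "(\<integral>\<^sup>+\<omega>. h (mahalanobis_sq \<Sigma> (X \<omega> - \<mu>)) \<partial>M)
      = ennreal (C / \<sigma>) * (\<integral>\<^sup>+y. 1 * (h (mahalanobis_sq \<Sigma> y) * ennreal (g (mahalanobis_sq \<Sigma> y))) \<partial>lborel)"
      unfolding factor[symmetric] mult_1
      by (rule nn_integral_GL_distributed[OF GL g_meas g_nonneg]) measurable
    also have "(\<integral>\<^sup>+y. 1 * (h (mahalanobis_sq \<Sigma> y) * ennreal (g (mahalanobis_sq \<Sigma> y))) \<partial>lborel)
      = ennreal (2 * \<sigma>) * ennreal ((real DIM(real ^ 'n) + 0) / 2) *
        (\<integral>\<^sup>+\<rho>. ennreal (\<rho> powr ((real DIM(real ^ 'n) + 0) / 2 - 1)) * indicator {0<..} \<rho> *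
           (h \<rho> * ennreal (g \<rho>)) \<partial>lborel)"
      by (rule nn_integral_homogeneous_times_radial_ball[OF _ _ _ _ _ _ _ _ V])
         (auto simp: mahalanobis_sq_scaleR mahalanobis_sq_pos[OF pd] n)
    also have "ennreal (C / \<sigma>) * \<dots> = ennreal (C / \<sigma>) * ennreal (2 * \<sigma>) * ennreal (1 / 2) *
        (\<integral>\<^sup>+\<rho>. ennreal (\<rho> powr (- 1 / 2)) * indicator {0<..} \<rho> * (h \<rho> * ennreal (g \<rho>)) \<partial>lborel)"
      by (simp add: n mult.assoc)
    also have "ennreal (C / \<sigma>) * ennreal (2 * \<sigma>) * ennreal (1 / 2) = ennreal (C / \<sigma> * (2 * \<sigma>) * (1 / 2))"
      using C \<sigma> by (subst (1 2) ennreal_mult) auto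
    also have "C / \<sigma> * (2 * \<sigma>) * (1 / 2) = C" using \<sigma> by simp
    finally show ?thesis .
  qed
  define f where "f = (\<lambda>\<rho>. indicator {0<..} \<rho> * (\<rho> powr (- 1 / 2) * g \<rho>))"
  have [measurable]: "f \<in> borel_measurable borel" unfolding f_def by measurable
  have f: "f \<rho> \<ge> 0" for \<rho> by (simp add: f_def g_nonneg)
  have radial_f: "ennreal (\<rho> powr (- 1 / 2)) * indicator {0<..} \<rho> * (ennreal c * ennreal (g \<rho>))
      = ennreal (f \<rho> * c)" if "c \<ge> 0" for \<rho> c
    using that by (auto simp: f_def indicator_def g_nonneg mult_ac simp flip: ennreal_mult)
  have "1 = ennreal C * (\<integral>\<^sup>+\<rho>. ennreal (f \<rho> * 1) \<partial>lborel)"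
    using radial[of "\<lambda>_. ennreal 1"] emeasure_space_1 by (simp only: radial_f) simp
  then have one: "1 = ennreal C * (\<integral>\<^sup>+\<rho>. ennreal (f \<rho>) \<partial>lborel)" by simp
  have "(\<integral>\<^sup>+\<rho>. ennreal (f \<rho>) \<partial>lborel) < \<infinity>"
  proof (rule ccontr)
    assume "\<not> (\<integral>\<^sup>+\<rho>. ennreal (f \<rho>) \<partial>lborel) < \<infinity>"
    then have "(\<integral>\<^sup>+\<rho>. ennreal (f \<rho>) \<partial>lborel) = \<infinity>" by (simp add: less_top[symmetric])
    then show False using one by (simp add: ennreal_mult_top split: if_splits)
  qed
  then have intf: "integrable lborel f" using f by (intro integrableI_nonneg) auto
  have intfc: "integrable lborel (\<lambda>\<rho>. f \<rho> * cos (t * \<sigma> * sqrt \<rho>))"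
    by (rule Bochner_Integration.integrable_bound[OF intf]) (use f in \<open>auto simp: abs_mult intro!: mult_left_le\<close>)
  have "ennreal 1 = ennreal (C * (\<integral>\<rho>. f \<rho> \<partial>lborel))"
    using one intf f C by (simp add: nn_integral_eq_integral ennreal_mult)
  then have one': "C * (\<integral>\<rho>. f \<rho> \<partial>lborel) = 1"
    using C f by (subst (asm) ennreal_inj) (auto intro!: mult_nonneg_nonneg integral_nonneg_AE)
  have cos_eq: "cos (vec t \<bullet> y) = cos (t * \<sigma> * sqrt (mahalanobis_sq \<Sigma> y))" for y :: "real ^ 'n"
  proof -
    have "vec t \<bullet> y = t * y $ i0" by (simp add: inner_vec_def i0)
    moreover have "norm y = \<bar>y $ i0\<bar>" by (simp add: norm_vec_def L2_set_def i0)
    then have "t * \<sigma> * sqrt (mahalanobis_sq \<Sigma> y) = t * \<bar>y $ i0\<bar>"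
      using \<sigma> by (simp add: Q real_sqrt_divide)
    ultimately show ?thesis by (cases "y $ i0 \<ge> 0") (simp_all only: abs_of_nonneg abs_of_neg
          not_le mult_minus_right cos_minus)
  qed
  \<comment> \<open>Adding \<open>1\<close> to the cosine makes nonnegative integrals applicable; the total mass removes it again.\<close>
  have cos_ge: "0 \<le> 1 + cos x" for x :: real using cos_ge_minus_one[of x] by linarith
  have shifted: "integrable lborel (\<lambda>\<rho>. f \<rho> * (1 + cos (t * \<sigma> * sqrt \<rho>)))"
    using intf intfc by (simp add: distrib_left)
  have shifted_nonneg: "0 \<le> f \<rho> * (1 + cos (t * \<sigma> * sqrt \<rho>))" for \<rho>
    by (intro mult_nonneg_nonneg f cos_ge)
  have "(\<integral>\<^sup>+\<omega>. ennreal (1 + cos (vec t \<bullet> (X \<omega> - \<mu>))) \<partial>M)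
      = (\<integral>\<^sup>+\<omega>. ennreal (1 + cos (t * \<sigma> * sqrt (mahalanobis_sq \<Sigma> (X \<omega> - \<mu>)))) \<partial>M)"
    by (simp only: cos_eq)
  also have "\<dots> = ennreal C * (\<integral>\<^sup>+\<rho>. ennreal (f \<rho> * (1 + cos (t * \<sigma> * sqrt \<rho>))) \<partial>lborel)"
    unfolding radial_f[OF cos_ge, symmetric] by (rule radial) measurable
  also have "(\<integral>\<^sup>+\<rho>. ennreal (f \<rho> * (1 + cos (t * \<sigma> * sqrt \<rho>))) \<partial>lborel)
      = ennreal (\<integral>\<rho>. f \<rho> * (1 + cos (t * \<sigma> * sqrt \<rho>)) \<partial>lborel)"
    by (rule nn_integral_eq_integral[OF shifted]) (intro AE_I2 shifted_nonneg)
  also have "ennreal C * \<dots> = ennreal (C * (\<integral>\<rho>. f \<rho> * (1 + cos (t * \<sigma> * sqrt \<rho>)) \<partial>lborel))"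
    using C by (simp add: ennreal_mult')
  finally have "expectation (\<lambda>\<omega>. 1 + cos (vec t \<bullet> (X \<omega> - \<mu>)))
      = C * (\<integral>\<rho>. f \<rho> * (1 + cos (t * \<sigma> * sqrt \<rho>)) \<partial>lborel)"
    using C cos_ge Bochner_Integration.integral_nonneg[OF shifted_nonneg, of lborel "\<lambda>\<rho>. \<rho>"]
    by (subst integral_eq_nn_integral) auto
  also have "\<dots> = 1 + C * (\<integral>\<rho>. f \<rho> * cos (t * \<sigma> * sqrt \<rho>) \<partial>lborel)"
    using intf intfc one' by (simp add: distrib_left)
  also have "expectation (\<lambda>\<omega>. 1 + cos (vec t \<bullet> (X \<omega> - \<mu>))) = 1 + expectation (\<lambda>\<omega>. cos (vec t \<bullet> (X \<omega> - \<mu>)))"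
  proof -
    have "integrable M (\<lambda>\<omega>. cos (vec t \<bullet> (X \<omega> - \<mu>)))"
      by (rule integrable_const_bound[where B = 1]) auto
    then show ?thesis by (simp add: prob_space)
  qed
  finally show ?thesis
    by (simp add: C_def f_def set_lebesgue_integral_def mult_ac)
qed

theorem theorem5p1:
  fixes M :: "'a measure"
    and X :: "'a \<Rightarrow> real ^ 'n"
    and \<mu> :: "real ^ 'n"
    and \<Sigma> :: "real ^ 'n ^ 'n"
    and N a b s r :: real
  assumes "2 * N + real CARD('n) > 2"
    and "a > 0" and "b > 0" and "s > 0" and "r \<ge> 0"
    and "pos_def_matrix \<Sigma>"
    and "GL_distributed M X \<mu> \<Sigma> (gl_generator N a b s r)"
  shows
    "(CARD('n) = 1 \<longrightarrow>
       (\<forall>(m::real) (\<sigma>::real) (t::real). \<sigma> > 0 \<and> \<mu> = vec m \<and> \<Sigma> = mat (\<sigma>\<^sup>2) \<longrightarrow>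
          char_fun M X (vec t) =
            of_real (gl_const \<mu> \<Sigma> (gl_generator N a b s r)) * exp (\<i> * of_real (t * m)) *
            of_real (LINT x:{0<..}|lborel.
              x powr (N - 3 / 2) * exp (- a * x powr s) / (1 + exp (- b * x powr s)) powr (2 * r) *
              cos (t * \<sigma> * sqrt x)))) \<and>
     (CARD('n) > 1 \<longrightarrow>
       (\<forall>t :: real ^ 'n.
          (s > 1 / 2 \<or> (s = 1 / 2 \<and> t \<bullet> (\<Sigma> *v t) < a\<^sup>2) \<longrightarrow>
             summable (gl_series_term N a b s r \<Sigma> t)) \<and>
          (summable (gl_series_term N a b s r \<Sigma> t) \<longrightarrow>
             char_fun M X t =
               exp (\<i> * of_real (t \<bullet> \<mu>)) * (\<Sum>j. gl_series_term N a b s r \<Sigma> t j))))"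
proof (intro conjI impI allI)
  define g where "g = gl_generator N a b s r"
  have g: "g \<in> borel_measurable borel" "\<And>x. g x \<ge> 0"
    by (simp_all add: g_def gl_generator_nonneg)
  have GL: "GL_distributed M X \<mu> \<Sigma> g" using assms(7) by (simp add: g_def)
  note pd = assms(6)
  interpret prob_space M using GL by (simp add: GL_distributed_def)
  note [measurable] = GL_distributed_measurable[OF GL g]
  {
    fix m \<sigma> t :: real
    assume n: "CARD('n) = 1" and *: "\<sigma> > 0 \<and> \<mu> = vec m \<and> \<Sigma> = mat (\<sigma>\<^sup>2)"
    have "vec t \<bullet> \<mu> = t * m" using * n by (simp add: inner_vec_def)
    moreover have "(LINT x:{0<..}|lborel. x powr (- 1 / 2) * g x * cos (t * \<sigma> * sqrt x))
       = (LINT x:{0<..}|lborel. x powr (N - 3 / 2) * exp (- a * x powr s) /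
            (1 + exp (- b * x powr s)) powr (2 * r) * cos (t * \<sigma> * sqrt x))"
    proof (rule set_lebesgue_integral_cong)
      show "\<forall>x. x \<in> {0<..} \<longrightarrow> x powr (- 1 / 2) * g x * cos (t * \<sigma> * sqrt x)
        = x powr (N - 3 / 2) * exp (- a * x powr s) /
            (1 + exp (- b * x powr s)) powr (2 * r) * cos (t * \<sigma> * sqrt x)"
      proof (intro allI impI)
        fix x :: real assume "x \<in> {0<..}"
        then have "x powr (- 1 / 2) * x powr (N - 1) = x powr (N - 3 / 2)"
          by (simp flip: powr_add)
        then show "x powr (- 1 / 2) * g x * cos (t * \<sigma> * sqrt x)
          = x powr (N - 3 / 2) * exp (- a * x powr s) /
              (1 + exp (- b * x powr s)) powr (2 * r) * cos (t * \<sigma> * sqrt x)"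
          by (simp only: g_def gl_generator_def times_divide_eq_right times_divide_eq_left mult.assoc[symmetric])
      qed
    qed simp
    moreover have "expectation (\<lambda>\<omega>. cos (vec t \<bullet> (X \<omega> - \<mu>)))
     = gl_const \<mu> \<Sigma> g * (LINT x:{0<..}|lborel. x powr (- 1 / 2) * g x * cos (t * \<sigma> * sqrt x))"
      using * GL_distributed_expectation_cos_univariate[of \<sigma> M X \<mu> g t] n pd GL g by simp
    ultimately show "char_fun M X (vec t) =
            of_real (gl_const \<mu> \<Sigma> (gl_generator N a b s r)) * exp (\<i> * of_real (t * m)) *
            of_real (LINT x:{0<..}|lborel.
              x powr (N - 3 / 2) * exp (- a * x powr s) / (1 + exp (- b * x powr s)) powr (2 * r) *
              cos (t * \<sigma> * sqrt x))"
      unfolding char_fun_GL_distributed[OF GL g] by (simp only: g_def of_real_mult mult_ac)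
  }
  fix t :: "real ^ 'n"
  assume n: "CARD('n) > 1"
  define \<sigma> where "\<sigma> = (\<lambda>j::nat. (real CARD('n) / 2 + real j + N - 1) / s)"
  define i where "i = (\<lambda>j. b powr (- \<sigma> j) / s * hurwitz_lerch_integral (2 * r) (\<sigma> j) (a / b))"
  define m where "m = (\<lambda>j. (t \<bullet> (\<Sigma> *v t)) ^ j * (Gamma (real j + 1 / 2) / sqrt pi) *
     (Gamma (real CARD('n) / 2) / Gamma (real CARD('n) / 2 + real j)) * (i j / i 0))"
  define Z where "Z = (\<lambda>\<omega>. t \<bullet> (X \<omega> - \<mu>))"
  have [measurable]: "Z \<in> borel_measurable M" unfolding Z_def by measurable
  have \<sigma>: "\<sigma> j > 0" for j using assms(1,4) by (simp add: \<sigma>_def)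
  have i: "(\<integral>\<^sup>+\<rho>. ennreal (\<rho> powr (real CARD('n) / 2 + real j - 1)) * indicator {0<..} \<rho> *
       ennreal (g \<rho>) \<partial>lborel) = ennreal (i j)" for j
    unfolding g_def i_def \<sigma>_def using assms by (intro nn_integral_gl_generator) auto
  have i_nonneg: "i j \<ge> 0" for j
    using assms \<sigma> nn_integral_hurwitz_lerch(2)[of "\<sigma> j" "a / b" "2 * r"] by (simp add: i_def)
  have u: "t \<bullet> (\<Sigma> *v t) \<ge> 0"
    using pd by (rule pos_def_matrix_inner_nonneg)
  have m_nonneg: "m j \<ge> 0" for j
    unfolding m_def using u i_nonneg Gamma_real_pos[of "real j + 1 / 2"]
      Gamma_real_pos[of "real CARD('n) / 2"] Gamma_real_pos[of "real CARD('n) / 2 + real j"]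
    by (intro mult_nonneg_nonneg divide_nonneg_nonneg) (auto simp: add_pos_nonneg)
  have m: "(\<integral>\<^sup>+\<omega>. ennreal (Z \<omega> ^ (2 * j)) \<partial>M) = ennreal (m j)" for j
    unfolding Z_def m_def by (rule GL_distributed_even_moment(1)[OF GL g pd i i_nonneg])
  have series: "gl_series_term N a b s r \<Sigma> t j = of_real ((-1) ^ j * m j / fact (2 * j))" for j
    unfolding m_def i_def \<sigma>_def using gl_series_term_moment[OF n assms(1,3,4)] by simp
  show "summable (gl_series_term N a b s r \<Sigma> t)"
    if "s > 1 / 2 \<or> (s = 1 / 2 \<and> t \<bullet> (\<Sigma> *v t) < a\<^sup>2)"
  proof -
    have "(\<integral>\<^sup>+\<omega>. ennreal (cosh (Z \<omega>)) \<partial>M) < \<infinity>"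
      unfolding Z_def
    proof (rule GL_distributed_exp_moment_finite[OF GL g pd])
      show "(\<integral>\<^sup>+\<rho>. ennreal (\<rho> powr (real CARD('n) / 2 - 1)) * indicator {0<..} \<rho> *
           ennreal (exp (sqrt (t \<bullet> (\<Sigma> *v t)) * sqrt \<rho>) * g \<rho>) \<partial>lborel) < \<infinity>"
        unfolding g_def using assms(1-5) u that
        by (intro nn_integral_gl_generator_exp_sqrt_finite) auto
    qed
    then have "summable (\<lambda>j. m j / fact (2 * j))"
      using m m_nonneg by (intro summable_even_moments) auto
    then have "summable (\<lambda>j. (-1) ^ j * m j / fact (2 * j))"
      using m_nonneg by (intro summable_rabs_cancel[of "\<lambda>j. (-1) ^ j * m j / fact (2 * j)"])
        (simp add: abs_mult)
    then show ?thesis unfolding series[abs_def] by (rule summable_of_real)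
  qed
  show "char_fun M X t = exp (\<i> * of_real (t \<bullet> \<mu>)) * (\<Sum>j. gl_series_term N a b s r \<Sigma> t j)"
    if "summable (gl_series_term N a b s r \<Sigma> t)"
  proof -
    have sm: "summable (\<lambda>j. (-1) ^ j * m j / fact (2 * j))"
      using summable_Re[OF that] by (simp only: series Re_complex_of_real)
    then have "expectation (\<lambda>\<omega>. cos (Z \<omega>)) = (\<Sum>j. (-1) ^ j * m j / fact (2 * j))"
      using m m_nonneg by (intro expectation_cos_even_moments) auto
    then have "complex_of_real (expectation (\<lambda>\<omega>. cos (Z \<omega>))) = (\<Sum>j. gl_series_term N a b s r \<Sigma> t j)"
      unfolding series suminf_of_real[OF sm, symmetric] by (simp only:)
    then show ?thesis
      unfolding char_fun_GL_distributed[OF GL g] Z_def by simp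
  qed
qed

end
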